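(* Let $N$ be a Liouville torus of an integrable system $(X_1,\ldots,X_p,F_1,\ldots,F_q)$ on a manifold $M$, and let $\mathcal{G}\in\Gamma(\otimes^h TM\otimes^k T^*M)$ be a tensor field on $M$ which is preserved by all the vector fields of the system: $\mathcal{L}_{X_i}\mathcal{G}=0$ for all $i=1,\ldots,p$. Then the Liouville torus $\mathbb{T}^p$-action on a tubular neighborhood $\mathcal{U}(N)$ of $N$ in $M$ also preserves $\mathcal{G}$.
   Context: All objects are smooth. An integrable system of type $(p,q)$ ($p\ge1$, $q\ge0$) on a manifold $M$ of dimension $m=p+q$ is a tuple $(X_1,\ldots,X_p,F_1,\ldots,F_q)$ of vector fields $X_i$ and functions $F_j$ on $M$ such that $[X_i,X_j]=0$ for all $i,j$; $X_i(F_j)=0$ for all $i,j$; and $X_1\wedge\cdots\wedge X_p\ne0$, $dF_1\wedge\cdots\wedge dF_q\neq0$ almost everywhere on $M$. A level set is a connected component $N$ of a joint level set $\{F_1=\mathrm{const},\ldots,F_q=\mathrm{const}\}$; the system is regular at $N$ if $X_1\wedge\cdots\wedge X_p\neq0$ and $dF_1\wedge\cdots\wedge dF_q\neq0$ everywhere on $N$. A Liouville torus is a compact level set at which the system is regular. By Liouville's theorem, a tubular neighborhood $\mathcal{U}(N)$ of a Liouville torus $N$ carries a free $\mathbb{T}^p$-action, unique up to automorphisms of $\mathbb{T}^p$, which preserves every $X_i$ and every $F_j$ and whose orbits are regular level sets of the system; it is called the Liouville torus action. Moreover $\mathcal{U}(N)\cong\mathbb{T}^p\times B^q$ ($B^q$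 a $q$-dimensional ball) with coordinates $(\theta_1 \bmod 1,\ldots,\theta_p \bmod 1,z_1,\ldots,z_q)$ in which the action is generated by $\partial/\partial\theta_1,\ldots,\partial/\partial\theta_p$, the $F_j$ depend only on $z$, and $X_i=\sum_j a_{ij}(z)\,\partial/\partial\theta_j$. *)

theory Defs
  imports "HOL-Analysis.Analysis" "HOL-Combinatorics.Permutations"
begin

section \<open>Smooth maps between Euclidean spaces\<close>

text \<open>For an open set \<open>S\<close>, \<open>Ck_on n S f\<close> says that \<open>f\<close> is of class \<open>C\<^sup>n\<close> on \<open>S\<close>.\<close>

primrec Ck_on ::
  "nat \<Rightarrow> 'a::euclidean_space set \<Rightarrow> ('a \<Rightarrow> 'b::real_normed_vector) \<Rightarrow> bool" where
  "Ck_on 0 S f \<longleftrightarrow> continuous_on S f"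
| "Ck_on (Suc n) S f \<longleftrightarrow>
     (\<forall>x\<in>S. f differentiable (at x)) \<and>
     (\<forall>v. Ck_on n S (\<lambda>x. frechet_derivative f (at x) v))"

definition smooth_on ::
  "'a::euclidean_space set \<Rightarrow> ('a \<Rightarrow> 'b::real_normed_vector) \<Rightarrow> bool" where
  "smooth_on S f \<longleftrightarrow> (\<forall>n. Ck_on n S f)"

definition Dmap ::
  "('a::euclidean_space \<Rightarrow> 'b::real_normed_vector) \<Rightarrow> 'a \<Rightarrow> 'a \<Rightarrow>\<^sub>L 'b" where
  "Dmap f x = Blinfun (frechet_derivative f (at x))"


section \<open>Smooth manifolds\<close>

text \<open>
  The underlying space of the manifold is a whole type \<open>'m\<close>, the model space is \<open>'e\<close>, and the
  smooth structure is given by an atlas, which need not be maximal.  Geometric objects are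
  given by their local expressions in the charts of the atlas together with the usual
  transformation laws.  A chart is a pair of an open domain and a map; the values of the map
  outside the domain are irrelevant.
\<close>

type_synonym ('m, 'e) chart = "'m set \<times> ('m \<Rightarrow> 'e)"

abbreviation cdom :: "('m, 'e) chart \<Rightarrow> 'm set" where
  "cdom c \<equiv> fst c"

abbreviation cmap :: "('m, 'e) chart \<Rightarrow> 'm \<Rightarrow> 'e" where
  "cmap c \<equiv> snd c"

definition cinv :: "('m, 'e) chart \<Rightarrow> 'e \<Rightarrow> 'm" where
  "cinv c = inv_into (cdom c) (cmap c)"

definition is_chart :: "('m::topological_space, 'e::euclidean_space) chart \<Rightarrow> bool" where
  "is_chart c \<longleftrightarrow> open (cdom c) \<and> open (cmap c ` cdom c) \<and>
     homeomorphism (cdom c) (cmap c ` cdom c) (cmap c) (cinv c)"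

definition smooth_atlas :: "('m::topological_space, 'e::euclidean_space) chart set \<Rightarrow> bool" where
  "smooth_atlas A \<longleftrightarrow>
     (\<forall>c\<in>A. is_chart c) \<and> (\<Union>c\<in>A. cdom c) = UNIV \<and>
     (\<forall>c\<in>A. \<forall>d\<in>A. smooth_on (cmap c ` (cdom c \<inter> cdom d)) (cmap d \<circ> cinv c))"

definition null_set :: "('m, 'e::euclidean_space) chart set \<Rightarrow> 'm set \<Rightarrow> bool" where
  "null_set A Z \<longleftrightarrow> (\<forall>c\<in>A. negligible (cmap c ` (Z \<inter> cdom c)))"

definition smooth_fun ::
  "('m, 'e::euclidean_space) chart set \<Rightarrow> 'm set \<Rightarrow> ('m \<Rightarrow> 'b::real_normed_vector) \<Rightarrow> bool" where
  "smooth_fun A W f \<longleftrightarrow> (\<forall>c\<in>A. smooth_on (cmap c ` (cdom c \<inter> W)) (f \<circ> cinv c))"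

definition dfun ::
  "('m, 'e::euclidean_space) chart \<Rightarrow> ('m \<Rightarrow> real) \<Rightarrow> 'm \<Rightarrow> 'e \<Rightarrow>\<^sub>L real" where
  "dfun c f x = Dmap (f \<circ> cinv c) (cmap c x)"

text \<open>
  The differential at \<open>x\<close> of a map \<open>f\<close> of the manifold to itself, in the chart \<open>c\<close> around \<open>x\<close>
  and the chart \<open>d\<close> around \<open>f x\<close>.  For \<open>f = id\<close> it is the Jacobian of the coordinate change.
\<close>

definition tangent_map ::
  "('m, 'e::euclidean_space) chart \<Rightarrow> ('m, 'e) chart \<Rightarrow> ('m \<Rightarrow> 'm) \<Rightarrow> 'm \<Rightarrow> 'e \<Rightarrow>\<^sub>L 'e" where
  "tangent_map c d f x = Dmap (cmap d \<circ> f \<circ> cinv c) (cmap c x)"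


section \<open>Vector fields\<close>

text \<open>\<open>X c x\<close> is the coordinate vector at \<open>x\<close> of the field in the chart \<open>c\<close>.\<close>

type_synonym ('m, 'e) vfield = "('m, 'e) chart \<Rightarrow> 'm \<Rightarrow> 'e"

definition vector_field ::
  "('m, 'e::euclidean_space) chart set \<Rightarrow> ('m, 'e) vfield \<Rightarrow> bool" where
  "vector_field A X \<longleftrightarrow>
     (\<forall>c\<in>A. smooth_on (cmap c ` cdom c) (X c \<circ> cinv c)) \<and>
     (\<forall>c\<in>A. \<forall>d\<in>A. \<forall>x\<in>cdom c \<inter> cdom d. X d x = tangent_map c d id x (X c x))"

definition vf_jacobian ::
  "('m, 'e::euclidean_space) chart \<Rightarrow> ('m, 'e) vfield \<Rightarrow> 'm \<Rightarrow> 'e \<Rightarrow>\<^sub>L 'e" where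
  "vf_jacobian c X x = Dmap (X c \<circ> cinv c) (cmap c x)"

definition lie_bracket ::
  "('m, 'e::euclidean_space) vfield \<Rightarrow> ('m, 'e) vfield \<Rightarrow> ('m, 'e) vfield" where
  "lie_bracket X Y c x = vf_jacobian c Y x (X c x) - vf_jacobian c X x (Y c x)"

definition vf_preserved ::
  "('m, 'e::euclidean_space) chart set \<Rightarrow> 'm set \<Rightarrow> ('m \<Rightarrow> 'm) \<Rightarrow> ('m, 'e) vfield \<Rightarrow> bool" where
  "vf_preserved A U f X \<longleftrightarrow>
     (\<forall>c\<in>A. \<forall>d\<in>A. \<forall>x\<in>U. x \<in> cdom c \<longrightarrow> f x \<in> cdom d \<longrightarrow>
        X d (f x) = tangent_map c d f x (X c x))"


section \<open>Tensor fields\<close>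

text \<open>
  \<open>G c x as vs\<close> is the value at \<open>x\<close>, in the chart \<open>c\<close>, of a section of
  \<open>\<Otimes>\<^sup>h TM \<otimes> \<Otimes>\<^sup>k T\<^sup>*M\<close> on a list \<open>as\<close> of \<open>h\<close> covectors and a list \<open>vs\<close> of \<open>k\<close> vectors.
  Lists of other lengths play no role.
\<close>

type_synonym ('m, 'e) tfield =
  "('m, 'e) chart \<Rightarrow> 'm \<Rightarrow> ('e \<Rightarrow>\<^sub>L real) list \<Rightarrow> 'e list \<Rightarrow> real"

definition multilinear ::
  "nat \<Rightarrow> nat \<Rightarrow> (('e::euclidean_space \<Rightarrow>\<^sub>L real) list \<Rightarrow> 'e list \<Rightarrow> real) \<Rightarrow> bool" where
  "multilinear h k T \<longleftrightarrow>
     (\<forall>as vs. length as = h \<longrightarrow> length vs = k \<longrightarrow>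
        (\<forall>i<h. linear (\<lambda>a. T (as[i := a]) vs)) \<and>
        (\<forall>j<k. linear (\<lambda>v. T as (vs[j := v]))))"

text \<open>
  The equation \<open>f\<^sup>* G = G\<close> on \<open>U\<close>, for a local diffeomorphism \<open>f\<close> defined on \<open>U\<close>.  For
  \<open>f = id\<close> it is the transformation law of tensors under coordinate changes.
\<close>

definition tensor_preserved ::
  "('m, 'e::euclidean_space) chart set \<Rightarrow> nat \<Rightarrow> nat \<Rightarrow> 'm set \<Rightarrow> ('m \<Rightarrow> 'm) \<Rightarrow>
   ('m, 'e) tfield \<Rightarrow> bool" where
  "tensor_preserved A h k U f G \<longleftrightarrow>
     (\<forall>c\<in>A. \<forall>d\<in>A. \<forall>x\<in>U. x \<in> cdom c \<longrightarrow> f x \<in> cdom d \<longrightarrow>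
       (\<forall>as vs. length as = h \<longrightarrow> length vs = k \<longrightarrow>
          G d (f x) as (map (blinfun_apply (tangent_map c d f x)) vs) =
          G c x (map (\<lambda>a. a o\<^sub>L tangent_map c d f x) as) vs))"

definition tensor_field ::
  "('m, 'e::euclidean_space) chart set \<Rightarrow> nat \<Rightarrow> nat \<Rightarrow> ('m, 'e) tfield \<Rightarrow> bool" where
  "tensor_field A h k G \<longleftrightarrow>
     (\<forall>c\<in>A. \<forall>x\<in>cdom c. multilinear h k (G c x)) \<and>
     (\<forall>c\<in>A. \<forall>as vs. length as = h \<longrightarrow> length vs = k \<longrightarrow>
        smooth_on (cmap c ` cdom c) (\<lambda>y. G c (cinv c y) as vs)) \<and>
     tensor_preserved A h k UNIV id G"

text \<open>
  \<open>(L\<^sub>X G)(\<alpha>\<^sub>1,\<dots>,\<alpha>\<^sub>h,v\<^sub>1,\<dots>,v\<^sub>k) = X(G(\<alpha>,v)) - \<Sum>\<^sub>i G(\<dots>,L\<^sub>X \<alpha>\<^sub>i,\<dots>,v) - \<Sum>\<^sub>j G(\<alpha>,\<dots>,[X,v\<^sub>j],\<dots>)\<close>.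
  The arguments are extended to fields that are constant in the chart, so that
  \<open>L\<^sub>X \<alpha> = \<alpha> \<circ> DX\<close> and \<open>[X,v] = - DX v\<close>.
\<close>

definition lie_derivative ::
  "('m, 'e::euclidean_space) vfield \<Rightarrow> ('m, 'e) tfield \<Rightarrow> ('m, 'e) tfield" where
  "lie_derivative X G c x as vs =
     Dmap (\<lambda>y. G c (cinv c y) as vs) (cmap c x) (X c x)
     - (\<Sum>i<length as. G c x (as[i := as ! i o\<^sub>L vf_jacobian c X x]) vs)
     + (\<Sum>j<length vs. G c x as (vs[j := vf_jacobian c X x (vs ! j)]))"

definition tensor_zero ::
  "('m, 'e::euclidean_space) chart set \<Rightarrow> nat \<Rightarrow> nat \<Rightarrow> ('m, 'e) tfield \<Rightarrow> bool" where
  "tensor_zero A h k G \<longleftrightarrow>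
     (\<forall>c\<in>A. \<forall>x\<in>cdom c. \<forall>as vs. length as = h \<longrightarrow> length vs = k \<longrightarrow> G c x as vs = 0)"


section \<open>Wedge products\<close>

text \<open>
  The value of \<open>\<alpha>\<^sub>1 \<and> \<dots> \<and> \<alpha>\<^sub>n\<close> on \<open>(v\<^sub>1,\<dots>,v\<^sub>n)\<close>, equivalently of \<open>v\<^sub>1 \<and> \<dots> \<and> v\<^sub>n\<close> on
  \<open>(\<alpha>\<^sub>1,\<dots>,\<alpha>\<^sub>n)\<close>: the determinant of \<open>(\<alpha>\<^sub>i(v\<^sub>j))\<close>.  The empty wedge product is \<open>1\<close>.
\<close>

definition wedge_eval ::
  "'i set \<Rightarrow> ('i \<Rightarrow> 'e::euclidean_space \<Rightarrow>\<^sub>L real) \<Rightarrow> ('i \<Rightarrow> 'e) \<Rightarrow> real" where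
  "wedge_eval I \<alpha> v = (\<Sum>\<sigma> | \<sigma> permutes I. of_int (sign \<sigma>) * (\<Prod>i\<in>I. \<alpha> i (v (\<sigma> i))))"

definition vectors_wedge_nonzero :: "'i set \<Rightarrow> ('i \<Rightarrow> 'e::euclidean_space) \<Rightarrow> bool" where
  "vectors_wedge_nonzero I v \<longleftrightarrow> (\<exists>\<alpha>. wedge_eval I \<alpha> v \<noteq> 0)"

definition covectors_wedge_nonzero ::
  "'i set \<Rightarrow> ('i \<Rightarrow> 'e::euclidean_space \<Rightarrow>\<^sub>L real) \<Rightarrow> bool" where
  "covectors_wedge_nonzero I \<alpha> \<longleftrightarrow> (\<exists>v. wedge_eval I \<alpha> v \<noteq> 0)"


section \<open>Integrable systems and Liouville tori\<close>

text \<open>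
  The fields are indexed by a finite type \<open>'p\<close> (so \<open>p = CARD('p) \<ge> 1\<close>) and the functions by
  the numbers \<open>j < q\<close>, where \<open>q = 0\<close> is allowed.
\<close>

definition independent_at ::
  "('m, 'e::euclidean_space) chart set \<Rightarrow> nat \<Rightarrow> ('p::finite \<Rightarrow> ('m, 'e) vfield) \<Rightarrow>
   (nat \<Rightarrow> 'm \<Rightarrow> real) \<Rightarrow> 'm \<Rightarrow> bool" where
  "independent_at A q X F x \<longleftrightarrow>
     (\<forall>c\<in>A. x \<in> cdom c \<longrightarrow>
        vectors_wedge_nonzero UNIV (\<lambda>i. X i c x) \<and>
        covectors_wedge_nonzero {..<q} (\<lambda>j. dfun c (F j) x))"

definition integrable_system ::
  "('m::topological_space, 'e::euclidean_space) chart set \<Rightarrow> nat \<Rightarrow>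
   ('p::finite \<Rightarrow> ('m, 'e) vfield) \<Rightarrow> (nat \<Rightarrow> 'm \<Rightarrow> real) \<Rightarrow> bool" where
  "integrable_system A q X F \<longleftrightarrow>
     DIM('e) = CARD('p) + q \<and>
     (\<forall>i. vector_field A (X i)) \<and>
     (\<forall>j<q. smooth_fun A UNIV (F j)) \<and>
     (\<forall>i i'. \<forall>c\<in>A. \<forall>x\<in>cdom c. lie_bracket (X i) (X i') c x = 0) \<and>
     (\<forall>i. \<forall>j<q. \<forall>c\<in>A. \<forall>x\<in>cdom c. dfun c (F j) x (X i c x) = 0) \<and>
     null_set A {x. \<not> independent_at A q X F x}"

definition level_set :: "nat \<Rightarrow> (nat \<Rightarrow> 'm::topological_space \<Rightarrow> real) \<Rightarrow> 'm set \<Rightarrow> bool" where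
  "level_set q F N \<longleftrightarrow> (\<exists>z. N \<in> components {x. \<forall>j<q. F j x = z j})"

definition regular_level_set ::
  "('m::topological_space, 'e::euclidean_space) chart set \<Rightarrow> nat \<Rightarrow>
   ('p::finite \<Rightarrow> ('m, 'e) vfield) \<Rightarrow> (nat \<Rightarrow> 'm \<Rightarrow> real) \<Rightarrow> 'm set \<Rightarrow> bool" where
  "regular_level_set A q X F N \<longleftrightarrow> level_set q F N \<and> (\<forall>x\<in>N. independent_at A q X F x)"

definition liouville_torus ::
  "('m::topological_space, 'e::euclidean_space) chart set \<Rightarrow> nat \<Rightarrow>
   ('p::finite \<Rightarrow> ('m, 'e) vfield) \<Rightarrow> (nat \<Rightarrow> 'm \<Rightarrow> real) \<Rightarrow> 'm set \<Rightarrow> bool" where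
  "liouville_torus A q X F N \<longleftrightarrow> compact N \<and> regular_level_set A q X F N"


section \<open>Tubular neighborhoods\<close>

text \<open>
  A diffeomorphism \<open>\<T>\<^sup>p \<times> B\<^sup>q \<rightarrow> U\<close> taking \<open>\<T>\<^sup>p \<times> {0}\<close> to \<open>N\<close> is given by a periodic map \<open>\<Psi>\<close>
  on the cylinder \<open>\<real>\<^sup>p \<times> B\<^sup>q\<close> in the model space \<open>'e\<close>: the angle coordinates of \<open>y\<close> are
  \<open>y \<bullet> b i\<close> for \<open>p\<close> of the basis vectors of \<open>'e\<close>, and \<open>transversal b y\<close> is the component of \<open>y\<close>
  in the span of the remaining \<open>q\<close>.  In this way \<open>q = 0\<close> needs no separate treatment, although
  there is no zero-dimensional Euclidean type.  The maps \<open>g\<close> are smooth local lifts of the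
  inverse diffeomorphism.
\<close>

definition transversal :: "('p::finite \<Rightarrow> 'e::euclidean_space) \<Rightarrow> 'e \<Rightarrow> 'e" where
  "transversal b y = y - (\<Sum>i\<in>UNIV. (y \<bullet> b i) *\<^sub>R b i)"

definition tubular_trivialization ::
  "('m::topological_space, 'e::euclidean_space) chart set \<Rightarrow> 'm set \<Rightarrow> 'm set \<Rightarrow>
   ('p::finite \<Rightarrow> 'e) \<Rightarrow> ('e \<Rightarrow> 'm) \<Rightarrow> bool" where
  "tubular_trivialization A N U b \<Psi> \<longleftrightarrow>
     (let C = {y. norm (transversal b y) < 1} in
       inj b \<and> range b \<subseteq> Basis \<and>
       \<Psi> ` C = U \<and> \<Psi> ` {y. transversal b y = 0} = N \<and>
       (\<forall>y\<in>C. \<forall>y'\<in>C. \<Psi> y = \<Psi> y' \<longleftrightarrow>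
          transversal b y = transversal b y' \<and> (\<forall>i. (y - y') \<bullet> b i \<in> \<int>)) \<and>
       continuous_on C \<Psi> \<and>
       (\<forall>c\<in>A. smooth_on {y\<in>C. \<Psi> y \<in> cdom c} (cmap c \<circ> \<Psi>)) \<and>
       (\<forall>x\<in>U. \<exists>W g. open W \<and> x \<in> W \<and> W \<subseteq> U \<and> smooth_fun A W g \<and>
          g ` W \<subseteq> C \<and> (\<forall>w\<in>W. \<Psi> (g w) = w)))"

definition tubular_neighborhood ::
  "('m::topological_space, 'e::euclidean_space) chart set \<Rightarrow> 'p::finite itself \<Rightarrow>
   'm set \<Rightarrow> 'm set \<Rightarrow> bool" where
  "tubular_neighborhood A p N U \<longleftrightarrow>
     open U \<and> (\<exists>(b :: 'p \<Rightarrow> 'e) \<Psi>. tubular_trivialization A N U b \<Psi>)"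


section \<open>Torus actions\<close>

text \<open>
  An action of \<open>\<T>\<^sup>p = \<real>\<^sup>p / \<int>\<^sup>p\<close> is an action of \<open>\<real>\<^sup>p\<close> in which the integer lattice acts
  trivially.
\<close>

definition integer_lattice :: "(real ^ 'p) set" where
  "integer_lattice = {t. \<forall>i. t $ i \<in> \<int>}"

definition torus_action ::
  "('m::topological_space, 'e::euclidean_space) chart set \<Rightarrow> 'm set \<Rightarrow>
   (real ^ 'p::finite \<Rightarrow> 'm \<Rightarrow> 'm) \<Rightarrow> bool" where
  "torus_action A U \<rho> \<longleftrightarrow>
     (\<forall>t. \<forall>x\<in>U. \<rho> t x \<in> U) \<and>
     (\<forall>x\<in>U. \<rho> 0 x = x) \<and>
     (\<forall>s t. \<forall>x\<in>U. \<rho> (s + t) x = \<rho> s (\<rho> t x)) \<and>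
     (\<forall>t\<in>integer_lattice. \<forall>x\<in>U. \<rho> t x = x) \<and>
     continuous_on (UNIV \<times> U) (\<lambda>(t, x). \<rho> t x) \<and>
     (\<forall>c\<in>A. \<forall>d\<in>A.
        smooth_on {(t, y). y \<in> cmap c ` (cdom c \<inter> U) \<and> \<rho> t (cinv c y) \<in> cdom d}
          (\<lambda>(t, y). cmap d (\<rho> t (cinv c y))))"

definition free_action :: "'m set \<Rightarrow> (real ^ 'p::finite \<Rightarrow> 'm \<Rightarrow> 'm) \<Rightarrow> bool" where
  "free_action U \<rho> \<longleftrightarrow> (\<forall>t. \<forall>x\<in>U. \<rho> t x = x \<longrightarrow> t \<in> integer_lattice)"

definition liouville_torus_action ::
  "('m::topological_space, 'e::euclidean_space) chart set \<Rightarrow> nat \<Rightarrow>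
   ('p::finite \<Rightarrow> ('m, 'e) vfield) \<Rightarrow> (nat \<Rightarrow> 'm \<Rightarrow> real) \<Rightarrow> 'm set \<Rightarrow>
   (real ^ 'p \<Rightarrow> 'm \<Rightarrow> 'm) \<Rightarrow> bool" where
  "liouville_torus_action A q X F U \<rho> \<longleftrightarrow>
     torus_action A U \<rho> \<and> free_action U \<rho> \<and>
     (\<forall>t i. vf_preserved A U (\<rho> t) (X i)) \<and>
     (\<forall>t. \<forall>j<q. \<forall>x\<in>U. F j (\<rho> t x) = F j x) \<and>
     (\<forall>x\<in>U. regular_level_set A q X F (range (\<lambda>t. \<rho> t x)))"

end

theory Submission
  imports Defs
begin

text \<open>
  Let \<open>x\<close> be a point of \<open>U\<close>, let \<open>v\<close> be a vector of the integer lattice, and let \<open>Z\<close> be the generator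
  of the circle action \<open>r \<mapsto> \<rho>\<^sub>r\<^sub>v\<close>.  The orbit of \<open>x\<close> is regular, so at \<open>x\<close> the fields \<open>X\<^sub>i\<close> span the
  common kernel of the \<open>dF\<^sub>j\<close> (\<open>spanned_by_system\<close>).  As \<open>\<rho>\<close> preserves the \<open>F\<^sub>j\<close>, the vector \<open>Z(x)\<close> lies in
  this kernel, and there are constants \<open>s\<^sub>i\<close> such that \<open>X = \<Sum>\<^sub>i s\<^sub>i X\<^sub>i\<close> agrees with \<open>Z\<close> at \<open>x\<close>.  Both fields are
  invariant under the action, so they agree on the whole orbit of \<open>x\<close>, but in general not nearby.

  The tensor \<open>G\<close> is preserved by \<open>X\<close>, so \<open>L\<^sub>Z G = - L\<^sub>Y G\<close> for \<open>Y = X - Z\<close>.  Since \<open>Y\<close> vanishes on the orbit,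
  \<open>L\<^sub>Y G\<close> involves there no derivative of \<open>G\<close>, but only the linear part \<open>B\<close> of \<open>Y\<close>
  (\<open>lie_derivative_generator_defect\<close>).  This linear part has two properties.  It is invariant
  (\<open>defect_jacobian_conjugate\<close>), so the pullbacks \<open>T(r) = \<rho>\<^sub>r\<^sub>v\<^sup>* G\<close> at \<open>x\<close> satisfy the linear equation
  \<open>T' = B \<cdot> T\<close> with constant coefficients, where \<open>B\<close> acts on tensors as a derivation
  (\<open>pullback_derivative_defect\<close>).  And \<open>B\<^sup>2 = 0\<close> (\<open>defect_jacobian_nilpotent\<close>): the values of \<open>B\<close> are
  tangent to the orbit because \<open>Y\<close> annihilates the \<open>F\<^sub>j\<close>, while \<open>B\<close> kills the tangent vectors \<open>X\<^sub>i\<close>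
  because \<open>Y\<close> commutes with the \<open>X\<^sub>i\<close>.

  Hence \<open>T\<close> is a polynomial in \<open>r\<close>.  It is also periodic, because \<open>\<rho>\<^sub>v = id\<close>, and a periodic polynomial is
  constant (\<open>nilpotent_periodic_constant\<close>).  So \<open>\<rho>\<^sub>r\<^sub>v\<close> preserves \<open>G\<close> for all \<open>r\<close>, and the transformations of
  this form with \<open>v\<close> a coordinate vector generate the torus.

  Everything is computed in charts.  The step from the formula for \<open>L\<^sub>Z G\<close> to the derivative of
  pullbacks (\<open>lie_derivative_generator\<close>) rests on the symmetry of second derivatives
  (\<open>frechet_derivative_symmetric\<close>), applied to the action as a function of time and space.
\<close>


section \<open>Nonvanishing wedge products\<close>

text \<open>Composing with the transposition of \<open>i\<close> and \<open>j\<close> pairs off the permutations with opposite signs.\<close>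

lemma wedge_eval_repeat:
  assumes I: "finite I" and i: "i \<in> I" and j: "j \<in> I" and ij: "i \<noteq> j" and v: "v i = v j"
  shows "wedge_eval I \<alpha> v = 0"
proof -
  let ?t = "Transposition.transpose i j"
  let ?f = "\<lambda>\<sigma>. of_int (sign \<sigma>) * (\<Prod>i\<in>I. \<alpha> i (v (\<sigma> i))) :: real"
  have t: "?t permutes I"
    using i j by (rule permutes_swap_id)
  have vt: "v (?t k) = v k" for k
    using v by (auto simp: Transposition.transpose_def)
  have "wedge_eval I \<alpha> v = (\<Sum>\<sigma> | \<sigma> permutes I. ?f (?t \<circ> \<sigma>))"
    unfolding wedge_eval_def by (rule setum_permutations_compose_left[OF t])
  also have "\<dots> = (\<Sum>\<sigma> | \<sigma> permutes I. - ?f \<sigma>)"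
  proof (rule sum.cong[OF refl])
    fix \<sigma> assume "\<sigma> \<in> {\<sigma>. \<sigma> permutes I}"
    then have "permutation \<sigma>"
      using I permutation_permutes by blast
    then have "sign (?t \<circ> \<sigma>) = - sign \<sigma>"
      using ij by (simp add: sign_compose permutation_swap_id sign_swap_id)
    then show "?f (?t \<circ> \<sigma>) = - ?f \<sigma>"
      by (simp add: vt)
  qed
  also have "\<dots> = - wedge_eval I \<alpha> v"
    by (simp add: wedge_eval_def sum_negf)
  finally show ?thesis by simp
qed

lemma wedge_eval_update:
  assumes I: "finite I" and k: "k \<in> I"
  shows "wedge_eval I \<alpha> (v(k := x)) =
    (\<Sum>\<sigma> | \<sigma> permutes I. of_int (sign \<sigma>) *
       (\<alpha> (inv \<sigma> k) x * (\<Prod>i\<in>I - {inv \<sigma> k}. \<alpha> i (v (\<sigma> i)))))"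
  unfolding wedge_eval_def
proof (rule sum.cong[OF refl])
  fix \<sigma> assume "\<sigma> \<in> {\<sigma>. \<sigma> permutes I}"
  then have \<sigma>: "\<sigma> permutes I" by simp
  have ik: "inv \<sigma> k \<in> I" and s: "\<sigma> (inv \<sigma> k) = k"
    using permutes_in_image[OF permutes_inv[OF \<sigma>]] k permutes_inverses(1)[OF \<sigma>] by auto
  have "(\<Prod>i\<in>I. \<alpha> i ((v(k := x)) (\<sigma> i))) =
      \<alpha> (inv \<sigma> k) x * (\<Prod>i\<in>I - {inv \<sigma> k}. \<alpha> i ((v(k := x)) (\<sigma> i)))"
    by (subst prod.remove[OF I ik]) (simp add: s)
  also have "(\<Prod>i\<in>I - {inv \<sigma> k}. \<alpha> i ((v(k := x)) (\<sigma> i))) =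
      (\<Prod>i\<in>I - {inv \<sigma> k}. \<alpha> i (v (\<sigma> i)))"
    by (rule prod.cong) (use permutes_inverses(2)[OF \<sigma>] in auto)
  finally show "of_int (sign \<sigma>) * (\<Prod>i\<in>I. \<alpha> i ((v(k := x)) (\<sigma> i))) =
      of_int (sign \<sigma>) * (\<alpha> (inv \<sigma> k) x * (\<Prod>i\<in>I - {inv \<sigma> k}. \<alpha> i (v (\<sigma> i))))" by simp
qed

lemma linear_wedge_eval_update:
  assumes I: "finite I" and k: "k \<in> I"
  shows "linear (\<lambda>x. wedge_eval I \<alpha> (v(k := x)))"
  unfolding wedge_eval_update[OF I k]
  by (rule linearI)
     (simp_all add: blinfun.add_right blinfun.scaleR_right sum.distrib[symmetric]
       algebra_simps sum_distrib_left)

text \<open>Cramer's rule: replacing \<open>v\<^sub>k\<close> by \<open>\<Sum>\<^sub>j c\<^sub>j v\<^sub>j\<close> multiplies the determinant by \<open>c\<^sub>k\<close>, and makes it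
  vanish if every \<open>\<alpha>\<^sub>i\<close> annihilates the combination.  Two special cases matter: the \<open>v\<^sub>j\<close> are linearly
  independent, and no nonzero combination of them lies in the common kernel of the \<open>\<alpha>\<^sub>i\<close>.\<close>

lemma wedge_eval_nonzero_coeffs_zero:
  assumes I: "finite I" and nz: "wedge_eval I \<alpha> v \<noteq> 0"
    and ann: "\<And>i. i \<in> I \<Longrightarrow> \<alpha> i (\<Sum>j\<in>I. c j *\<^sub>R v j) = 0" and k: "k \<in> I"
  shows "c k = 0"
proof -
  let ?L = "\<lambda>x. wedge_eval I \<alpha> (v(k := x))"
  interpret linear ?L
    using I k by (rule linear_wedge_eval_update)
  have "?L (v j) = 0" if "j \<in> I" "j \<noteq> k" for j
    by (rule wedge_eval_repeat[OF I k that(1)]) (use that in auto)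
  then have *: "?L (v j) = (if j = k then wedge_eval I \<alpha> v else 0)" if "j \<in> I" for j
    using that by auto
  have "?L (\<Sum>j\<in>I. c j *\<^sub>R v j) = (\<Sum>j\<in>I. c j * ?L (v j))"
    by (simp add: sum scale)
  also have "\<dots> = (\<Sum>j\<in>I. if j = k then c k * wedge_eval I \<alpha> v else 0)"
    by (rule sum.cong) (auto simp: *)
  also have "\<dots> = c k * wedge_eval I \<alpha> v"
    using I k by (simp add: sum.delta)
  finally have "?L (\<Sum>j\<in>I. c j *\<^sub>R v j) = c k * wedge_eval I \<alpha> v" .
  moreover have "?L (\<Sum>j\<in>I. c j *\<^sub>R v j) = 0"
    unfolding wedge_eval_update[OF I k]
  proof (intro sum.neutral ballI)
    fix \<sigma> assume "\<sigma> \<in> {\<sigma>. \<sigma> permutes I}"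
    then have "inv \<sigma> k \<in> I"
      using k by (simp add: permutes_in_image permutes_inv)
    then show "of_int (sign \<sigma>) * (\<alpha> (inv \<sigma> k) (\<Sum>j\<in>I. c j *\<^sub>R v j) *
        (\<Prod>i\<in>I - {inv \<sigma> k}. \<alpha> i (v (\<sigma> i)))) = 0"
      using ann by simp
  qed
  ultimately show ?thesis
    using nz by simp
qed

lemma independent_family:
  fixes u :: "'i \<Rightarrow> 'e::euclidean_space"
  assumes I: "finite I" and z: "\<forall>c::'i \<Rightarrow> real. (\<Sum>i\<in>I. c i *\<^sub>R u i) = 0 \<longrightarrow> (\<forall>k\<in>I. c k = 0)"
  shows "inj_on u I" and "independent (u ` I)"
proof -
  show inj: "inj_on u I"
  proof (rule inj_onI, rule ccontr)
    fix i j assume ij: "i \<in> I" "j \<in> I" "u i = u j" "i \<noteq> j"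
    let ?c = "\<lambda>l. if l = i then 1 else if l = j then - 1 else (0::real)"
    have "(\<Sum>l\<in>I. ?c l *\<^sub>R u l) = (\<Sum>l\<in>{i, j}. ?c l *\<^sub>R u l)"
      by (rule sum.mono_neutral_right) (use I ij in auto)
    also have "\<dots> = 0"
      using ij by simp
    finally have "?c i = 0"
      using z[rule_format, OF _ ij(1), of ?c] by blast
    then show False by simp
  qed
  show "independent (u ` I)"
    unfolding independent_explicit
  proof (intro conjI allI impI ballI)
    show "finite (u ` I)" using I by simp
    fix c x assume 0: "(\<Sum>v\<in>u ` I. c v *\<^sub>R v) = 0" and x: "x \<in> u ` I"
    have "(\<Sum>i\<in>I. c (u i) *\<^sub>R u i) = 0"
      using 0 by (simp add: sum.reindex[OF inj])
    then show "c x = 0"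
      using z[rule_format, of "\<lambda>i. c (u i)"] x by auto
  qed
qed

text \<open>A dimension count.  Vectors \<open>w\<^sub>j\<close> with \<open>det (\<beta>\<^sub>i(w\<^sub>j)) \<noteq> 0\<close> span a complement of the common kernel of
  the \<open>\<beta>\<^sub>j\<close>; this leaves dimension \<open>card I\<close> for the kernel, which the independent \<open>u\<^sub>i\<close> exhaust.\<close>

lemma common_kernel_spanned:
  fixes u :: "'i \<Rightarrow> 'e::euclidean_space" and \<beta> :: "'j \<Rightarrow> 'e \<Rightarrow>\<^sub>L real"
  assumes I: "finite I" and J: "finite J" and dim: "DIM('e) = card I + card J"
    and u: "vectors_wedge_nonzero I u" and \<beta>: "covectors_wedge_nonzero J \<beta>"
    and \<beta>u: "\<And>i j. i \<in> I \<Longrightarrow> j \<in> J \<Longrightarrow> \<beta> j (u i) = 0"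
    and z: "\<And>j. j \<in> J \<Longrightarrow> \<beta> j z = 0"
  obtains s where "z = (\<Sum>i\<in>I. s i *\<^sub>R u i)"
proof -
  obtain \<alpha> where \<alpha>: "wedge_eval I \<alpha> u \<noteq> 0"
    using u by (auto simp: vectors_wedge_nonzero_def)
  obtain w where w: "wedge_eval J \<beta> w \<noteq> 0"
    using \<beta> by (auto simp: covectors_wedge_nonzero_def)
  have uz: "c k = 0" if "(\<Sum>i\<in>I. c i *\<^sub>R u i) = 0" "k \<in> I" for c k
    by (rule wedge_eval_nonzero_coeffs_zero[OF I \<alpha> _ that(2)]) (simp add: that(1))
  have wz: "c k = 0" if "(\<Sum>i\<in>J. c i *\<^sub>R w i) = 0" "k \<in> J" for c k
    by (rule wedge_eval_nonzero_coeffs_zero[OF J w _ that(2)]) (simp add: that(1))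
  have iu: "inj_on u I" "independent (u ` I)" and iw: "inj_on w J" "independent (w ` J)"
    using independent_family[OF I, of u] independent_family[OF J, of w] uz wz by blast+
  have spu: "\<exists>s. x = (\<Sum>i\<in>I. s i *\<^sub>R u i)" if "x \<in> span (u ` I)" for x
    using that I by (auto simp: span_finite sum.reindex[OF iu(1)])
  have spw: "\<exists>s. x = (\<Sum>i\<in>J. s i *\<^sub>R w i)" if "x \<in> span (w ` J)" for x
    using that J by (auto simp: span_finite sum.reindex[OF iw(1)])
  have \<beta>S: "\<beta> j x = 0" if "x \<in> span (u ` I)" "j \<in> J" for x j
    using spu[OF that(1)] \<beta>u that(2) by (auto simp: blinfun.sum_right blinfun.scaleR_right)
  have T0: "x = 0" if xT: "x \<in> span (w ` J)" and x0: "\<And>j. j \<in> J \<Longrightarrow> \<beta> j x = 0" for x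
  proof -
    obtain c where c: "x = (\<Sum>i\<in>J. c i *\<^sub>R w i)"
      using spw[OF xT] by blast
    have "c k = 0" if "k \<in> J" for k
      by (rule wedge_eval_nonzero_coeffs_zero[OF J w _ that]) (use x0 c in auto)
    then show ?thesis
      by (simp add: c)
  qed
  let ?ST = "{x + y |x y. x \<in> span (u ` I) \<and> y \<in> span (w ` J)}"
  have "span (u ` I) \<inter> span (w ` J) = {0}"
    using T0 \<beta>S by (auto simp: span_zero)
  then have "dim ?ST = card I + card J"
    using dim_sums_Int[OF subspace_span subspace_span, of "u ` I" "w ` J"] iu iw
    by (simp add: dim_eq_card_independent card_image)
  then have "dim ?ST = DIM('e)"
    using dim by simp
  then have "span ?ST = UNIV"
    by (simp add: dim_eq_full)
  moreover have "span ?ST = ?ST"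
    unfolding span_eq_iff by (intro subspace_sums subspace_span)
  ultimately have "?ST = UNIV"
    by (rule trans[OF sym, rotated])
  then have "z \<in> ?ST"
    by (simp only: UNIV_I)
  then obtain x y where xy: "z = x + y" "x \<in> span (u ` I)" "y \<in> span (w ` J)"
    by blast
  have "y = 0"
  proof (rule T0[OF xy(3)])
    fix j assume "j \<in> J"
    then show "\<beta> j y = 0"
      using z[of j] \<beta>S[OF xy(2), of j] by (simp add: xy(1) blinfun.add_right)
  qed
  then show thesis
    using spu[OF xy(2)] xy(1) that by auto
qed


section \<open>Symmetry of second derivatives\<close>

text \<open>Two applications of the mean value theorem, first in the direction \<open>v\<close> and then in \<open>w\<close>.  The left-hand
  side is symmetric in \<open>v\<close> and \<open>w\<close>, from which the symmetry of second derivatives follows as \<open>h \<rightarrow> 0\<close>.\<close>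

lemma second_difference_mean_value:
  fixes f :: "'a::euclidean_space \<Rightarrow> real"
  assumes h: "0 < h"
    and sub: "\<And>a b. 0 \<le> a \<Longrightarrow> a \<le> h \<Longrightarrow> 0 \<le> b \<Longrightarrow> b \<le> h \<Longrightarrow> x + a *\<^sub>R v + b *\<^sub>R w \<in> S"
    and f: "\<And>y. y \<in> S \<Longrightarrow> f differentiable (at y)"
    and fv: "\<And>y. y \<in> S \<Longrightarrow> (\<lambda>y. frechet_derivative f (at y) v) differentiable (at y)"
  shows "\<exists>a b. 0 \<le> a \<and> a \<le> h \<and> 0 \<le> b \<and> b \<le> h \<and>
    f (x + h *\<^sub>R v + h *\<^sub>R w) - f (x + h *\<^sub>R v) - f (x + h *\<^sub>R w) + f x =
    h * h * frechet_derivative (\<lambda>y. frechet_derivative f (at y) v) (at (x + a *\<^sub>R v + b *\<^sub>R w)) w"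
proof -
  let ?fv = "\<lambda>y. frechet_derivative f (at y) v"
  let ?fvw = "\<lambda>y. frechet_derivative ?fv (at y) w"
  have Df: "((\<lambda>a. f (y + a *\<^sub>R v)) has_real_derivative ?fv (y + a *\<^sub>R v)) (at a)"
    if "y + a *\<^sub>R v \<in> S" for y a
  proof -
    have "(f has_derivative frechet_derivative f (at (y + a *\<^sub>R v))) (at (y + a *\<^sub>R v))"
      using f[OF that] by (simp add: frechet_derivative_works)
    from diff_chain_at[of "\<lambda>a. y + a *\<^sub>R v" "\<lambda>r. r *\<^sub>R v", OF _ this]
    have "((\<lambda>a. f (y + a *\<^sub>R v)) has_derivative
        (\<lambda>r. frechet_derivative f (at (y + a *\<^sub>R v)) (r *\<^sub>R v))) (at a)"
      unfolding o_def by this (auto intro!: derivative_eq_intros)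
    then show ?thesis
      using linear_frechet_derivative[OF f[OF that]]
      by (simp add: has_field_derivative_def linear_scale mult_commute_abs)
  qed
  have Dfv: "((\<lambda>b. ?fv (y + b *\<^sub>R w)) has_real_derivative ?fvw (y + b *\<^sub>R w)) (at b)"
    if "y + b *\<^sub>R w \<in> S" for y b
  proof -
    have "(?fv has_derivative frechet_derivative ?fv (at (y + b *\<^sub>R w))) (at (y + b *\<^sub>R w))"
      using fv[OF that] by (simp add: frechet_derivative_works)
    from diff_chain_at[of "\<lambda>a. y + a *\<^sub>R w" "\<lambda>r. r *\<^sub>R w", OF _ this]
    have "((\<lambda>a. ?fv (y + a *\<^sub>R w)) has_derivative
        (\<lambda>r. frechet_derivative ?fv (at (y + b *\<^sub>R w)) (r *\<^sub>R w))) (at b)"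
      unfolding o_def by this (auto intro!: derivative_eq_intros)
    then show ?thesis
      using linear_frechet_derivative[OF fv[OF that]]
      by (simp add: has_field_derivative_def linear_scale mult_commute_abs)
  qed
  let ?g = "\<lambda>a. f (x + h *\<^sub>R w + a *\<^sub>R v) - f (x + a *\<^sub>R v)"
  have Dg: "(?g has_real_derivative ?fv (x + h *\<^sub>R w + a *\<^sub>R v) - ?fv (x + a *\<^sub>R v)) (at a)"
    if "0 \<le> a" "a \<le> h" for a
  proof (intro DERIV_diff Df)
    show "x + h *\<^sub>R w + a *\<^sub>R v \<in> S" "x + a *\<^sub>R v \<in> S"
      using sub[of a h] sub[of a 0] that h by (simp_all add: ac_simps)
  qed
  obtain a where a: "0 < a" "a < h"
    and ga: "?g h - ?g 0 = (h - 0) * (?fv (x + h *\<^sub>R w + a *\<^sub>R v) - ?fv (x + a *\<^sub>R v))"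
    using MVT2[OF h Dg] by auto
  have Dk: "((\<lambda>b. ?fv (x + a *\<^sub>R v + b *\<^sub>R w)) has_real_derivative
      ?fvw (x + a *\<^sub>R v + b *\<^sub>R w)) (at b)" if "0 \<le> b" "b \<le> h" for b
    using sub[of a b] a that by (intro Dfv) auto
  obtain b where b: "0 < b" "b < h"
    and kb: "?fv (x + a *\<^sub>R v + h *\<^sub>R w) - ?fv (x + a *\<^sub>R v + 0 *\<^sub>R w) =
      (h - 0) * ?fvw (x + a *\<^sub>R v + b *\<^sub>R w)"
    using MVT2[OF h Dk] by auto
  have "?g h - ?g 0 = h * (h * ?fvw (x + a *\<^sub>R v + b *\<^sub>R w))"
    using ga kb by (simp add: ac_simps)
  then show ?thesis
    using a b by (intro exI[of _ a] exI[of _ b]) (simp add: ac_simps)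
qed

lemma frechet_derivative_symmetric_real:
  fixes f :: "'a::euclidean_space \<Rightarrow> real"
  assumes S: "open S" "x \<in> S" and f: "Ck_on 2 S f"
  shows "frechet_derivative (\<lambda>y. frechet_derivative f (at y) v) (at x) w =
         frechet_derivative (\<lambda>y. frechet_derivative f (at y) w) (at x) v"
proof -
  let ?D = "\<lambda>v w y. frechet_derivative (\<lambda>y. frechet_derivative f (at y) v) (at y) w"
  have df: "f differentiable (at y)" "(\<lambda>y. frechet_derivative f (at y) v) differentiable (at y)"
    and cont: "continuous_on S (?D v w)" if "y \<in> S" for y v w
    using f that by (simp_all add: numeral_2_eq_2)
  have cont: "continuous_on S (?D v w)" for v w
    using cont S by blast
  obtain e where e: "e > 0" "ball x e \<subseteq> S"
    using S open_contains_ball by blast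
  \<comment> \<open>parallelograms with sides \<open>a v\<close> and \<open>b w\<close>, \<open>a, b \<le> \<delta>\<close>, stay in the ball of radius \<open>e\<close>\<close>
  define \<delta> where "\<delta> = e / (norm v + norm w + 1)"
  have pos: "norm v + norm w + 1 > 0"
    by (simp add: add_nonneg_pos)
  have \<delta>: "\<delta> > 0" "\<delta> * (norm v + norm w) < e"
  proof -
    show "\<delta> > 0" using e pos by (simp add: \<delta>_def)
    have "\<delta> * (norm v + norm w + 1) = e" using pos by (simp add: \<delta>_def)
    then show "\<delta> * (norm v + norm w) < e" using \<open>\<delta> > 0\<close> by (simp add: algebra_simps)
  qed
  define h where "h n = \<delta> / real (Suc n)" for n
  have h: "h n > 0" "h n \<le> \<delta>" for n
    using \<delta> by (auto simp: h_def divide_simps)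
  have h0: "h \<longlonglongrightarrow> 0"
    unfolding h_def by (intro real_tendsto_divide_at_top[OF tendsto_const]
        filterlim_compose[OF filterlim_real_sequentially filterlim_Suc])
  have sub: "x + a *\<^sub>R v + b *\<^sub>R w \<in> S" if "0 \<le> a" "a \<le> h n" "0 \<le> b" "b \<le> h n" for a b n
  proof -
    have "norm (a *\<^sub>R v + b *\<^sub>R w) \<le> a * norm v + b * norm w"
      using norm_triangle_ineq[of "a *\<^sub>R v" "b *\<^sub>R w"] that by simp
    also have "\<dots> \<le> \<delta> * norm v + \<delta> * norm w"
      using that h(2)[of n] by (intro add_mono mult_right_mono) auto
    also have "\<dots> < e" using \<delta> by (simp add: algebra_simps)
    finally have "x + (a *\<^sub>R v + b *\<^sub>R w) \<in> ball x e"
      by (simp only: mem_ball dist_norm norm_minus_commute[of x]) simp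
    then show ?thesis using e by (auto simp: add.assoc)
  qed
  let ?\<Delta> = "\<lambda>h. f (x + h *\<^sub>R v + h *\<^sub>R w) - f (x + h *\<^sub>R v) - f (x + h *\<^sub>R w) + f x"
  have "\<exists>a b. 0 \<le> a \<and> a \<le> h n \<and> 0 \<le> b \<and> b \<le> h n \<and>
      ?\<Delta> (h n) = h n * h n * ?D v w (x + a *\<^sub>R v + b *\<^sub>R w)" for n
    by (rule second_difference_mean_value[OF h(1) sub df]) auto
  then obtain a b where ab: "\<And>n. 0 \<le> a n \<and> a n \<le> h n \<and> 0 \<le> b n \<and> b n \<le> h n \<and>
      ?\<Delta> (h n) = h n * h n * ?D v w (x + a n *\<^sub>R v + b n *\<^sub>R w)"
    by metis
  have "\<exists>c d. 0 \<le> c \<and> c \<le> h n \<and> 0 \<le> d \<and> d \<le> h n \<and>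
      f (x + h n *\<^sub>R w + h n *\<^sub>R v) - f (x + h n *\<^sub>R w) - f (x + h n *\<^sub>R v) + f x =
      h n * h n * ?D w v (x + c *\<^sub>R w + d *\<^sub>R v)" for n
    by (rule second_difference_mean_value[OF h(1) _ df])
       (auto simp: add.assoc add.commute[of "_ *\<^sub>R w"] intro: sub[unfolded add.assoc])
  then obtain c d where cd: "\<And>n. 0 \<le> c n \<and> c n \<le> h n \<and> 0 \<le> d n \<and> d n \<le> h n \<and>
      f (x + h n *\<^sub>R w + h n *\<^sub>R v) - f (x + h n *\<^sub>R w) - f (x + h n *\<^sub>R v) + f x =
      h n * h n * ?D w v (x + c n *\<^sub>R w + d n *\<^sub>R v)"
    by metis
  have lim0: "g \<longlonglongrightarrow> 0" if "\<And>n. 0 \<le> g n \<and> g n \<le> h n" for g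
    by (rule tendsto_sandwich[OF _ _ tendsto_const h0]) (use that in auto)
  have "(\<lambda>n. x + a n *\<^sub>R v + b n *\<^sub>R w) \<longlonglongrightarrow> x + 0 *\<^sub>R v + 0 *\<^sub>R w"
    using ab by (intro tendsto_intros lim0) auto
  then have 1: "(\<lambda>n. ?D v w (x + a n *\<^sub>R v + b n *\<^sub>R w)) \<longlonglongrightarrow> ?D v w x"
    using isCont_tendsto_compose[of x "?D v w"] cont[of v w] S
    by (simp add: continuous_on_eq_continuous_at)
  have "(\<lambda>n. x + c n *\<^sub>R w + d n *\<^sub>R v) \<longlonglongrightarrow> x + 0 *\<^sub>R w + 0 *\<^sub>R v"
    using cd by (intro tendsto_intros lim0) auto
  then have 2: "(\<lambda>n. ?D w v (x + c n *\<^sub>R w + d n *\<^sub>R v)) \<longlonglongrightarrow> ?D w v x"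
    using isCont_tendsto_compose[of x "?D w v"] cont[of w v] S
    by (simp add: continuous_on_eq_continuous_at)
  have eq: "?D w v (x + c n *\<^sub>R w + d n *\<^sub>R v) = ?D v w (x + a n *\<^sub>R v + b n *\<^sub>R w)" for n
  proof -
    have "h n * h n * ?D w v (x + c n *\<^sub>R w + d n *\<^sub>R v) =
        f (x + h n *\<^sub>R w + h n *\<^sub>R v) - f (x + h n *\<^sub>R w) - f (x + h n *\<^sub>R v) + f x"
      using cd[of n] by (elim conjE) (rule sym)
    also have "\<dots> = ?\<Delta> (h n)"
      by (simp add: ac_simps)
    also have "\<dots> = h n * h n * ?D v w (x + a n *\<^sub>R v + b n *\<^sub>R w)"
      using ab[of n] by (elim conjE)
    finally have "h n * h n * ?D w v (x + c n *\<^sub>R w + d n *\<^sub>R v) =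
        h n * h n * ?D v w (x + a n *\<^sub>R v + b n *\<^sub>R w)" .
    then show ?thesis using h(1)[of n] by simp
  qed
  have "(\<lambda>n. ?D v w (x + a n *\<^sub>R v + b n *\<^sub>R w)) \<longlonglongrightarrow> ?D w v x"
    using 2 by (simp only: eq)
  with 1 show ?thesis
    by (rule LIMSEQ_unique)
qed

lemma frechet_derivative_inner:
  assumes "f differentiable (at x)"
  shows "frechet_derivative (\<lambda>y. f y \<bullet> b) (at x) v = frechet_derivative f (at x) v \<bullet> b"
proof -
  have "((\<lambda>y. f y \<bullet> b) has_derivative (\<lambda>v. frechet_derivative f (at x) v \<bullet> b)) (at x)"
    using assms by (intro has_derivative_inner_left) (simp add: frechet_derivative_works)
  from fun_cong[OF frechet_derivative_at[OF this], of v] show ?thesis by simp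
qed

lemma frechet_derivative_cong_open:
  assumes "open S" "x \<in> S" "\<And>y. y \<in> S \<Longrightarrow> f y = g y"
  shows "frechet_derivative f (at x) = frechet_derivative g (at x)"
proof -
  have "(f has_derivative D) (at x) \<longleftrightarrow> (g has_derivative D) (at x)" for D
    using has_derivative_transform_within_open[OF _ assms(1,2), of f D UNIV g]
      has_derivative_transform_within_open[OF _ assms(1,2), of g D UNIV f] assms(3) by auto
  then show ?thesis
    by (simp add: frechet_derivative_def)
qed

lemma differentiable_cong_open:
  assumes "open S" "x \<in> S" "f differentiable (at x)" "\<And>y. y \<in> S \<Longrightarrow> f y = g y"
  shows "g differentiable (at x)"
proof -
  obtain D where "(f has_derivative D) (at x)"
    using assms(3) by (auto simp: differentiable_def)
  then have "(g has_derivative D) (at x)"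
    using assms(1,2) by (rule has_derivative_transform_within_open) (rule assms(4))
  then show ?thesis
    by (auto simp: differentiable_def)
qed

lemma frechet_derivative_symmetric:
  fixes f :: "'a::euclidean_space \<Rightarrow> 'b::euclidean_space"
  assumes S: "open S" "x \<in> S" and f: "smooth_on S f"
  shows "frechet_derivative (\<lambda>y. frechet_derivative f (at y) v) (at x) w =
         frechet_derivative (\<lambda>y. frechet_derivative f (at y) w) (at x) v"
proof (rule euclidean_eqI)
  fix b :: 'b assume "b \<in> Basis"
  have f2: "Ck_on 2 S f" using f by (simp add: smooth_on_def)
  have df: "f differentiable (at y)" "(\<lambda>y. frechet_derivative f (at y) v) differentiable (at y)"
    and cont: "continuous_on S (\<lambda>y. frechet_derivative (\<lambda>y. frechet_derivative f (at y) v) (at y) w)"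
    if "y \<in> S" for y v w
    using f2 that by (simp_all add: numeral_2_eq_2)
  let ?f = "\<lambda>y. f y \<bullet> b"
  have 1: "frechet_derivative ?f (at y) v = frechet_derivative f (at y) v \<bullet> b" if "y \<in> S" for y v
    using df(1)[OF that] by (rule frechet_derivative_inner)
  have eq: "frechet_derivative (\<lambda>y. frechet_derivative ?f (at y) v) (at y) =
      frechet_derivative (\<lambda>y. frechet_derivative f (at y) v \<bullet> b) (at y)" if "y \<in> S" for y v
    by (rule frechet_derivative_cong_open[OF S(1) that]) (rule 1)
  have 2: "frechet_derivative (\<lambda>y. frechet_derivative ?f (at y) v) (at y) w =
      frechet_derivative (\<lambda>y. frechet_derivative f (at y) v) (at y) w \<bullet> b" if "y \<in> S" for y v w
    unfolding eq[OF that] using df(2)[OF that] by (rule frechet_derivative_inner)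
  have "(\<lambda>y. frechet_derivative ?f (at y) v) differentiable (at y)" if "y \<in> S" for y v
  proof -
    have "(\<lambda>y. frechet_derivative f (at y) v \<bullet> b) differentiable (at y)"
      using df(2)[OF that] by simp
    then show ?thesis
      by (rule differentiable_cong_open[OF S(1) that]) (simp add: 1)
  qed
  moreover have "continuous_on S (\<lambda>y. frechet_derivative (\<lambda>y. frechet_derivative ?f (at y) v) (at y) w)"
    for v w
    using continuous_on_inner[OF cont[OF S(2), of v w] continuous_on_const[of S b]]
    by (simp add: 2 cong: continuous_on_cong)
  ultimately have "Ck_on 2 S ?f"
    using df(1) by (simp add: numeral_2_eq_2)
  from frechet_derivative_symmetric_real[OF S this, of v w]
  show "frechet_derivative (\<lambda>y. frechet_derivative f (at y) v) (at x) w \<bullet> b =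
      frechet_derivative (\<lambda>y. frechet_derivative f (at y) w) (at x) v \<bullet> b"
    using S by (simp add: 2)
qed


section \<open>Differentiating multilinear expressions\<close>

text \<open>Only derivatives at constant arguments are given, and no joint regularity of \<open>T\<close> in time and arguments.
  This is enough because each moving argument expands in the finite basis \<open>\<beta>\<close> with differentiable
  coordinates \<open>\<phi>\<close>; the slots are treated one at a time.  The basis is a parameter so that vectors and
  covectors are covered alike.\<close>

lemma has_real_derivative_multilinear_list:
  fixes T :: "real \<Rightarrow> 'v::real_normed_vector list \<Rightarrow> real" and \<beta> :: "'i \<Rightarrow> 'v"
  assumes I: "finite I" "\<And>i. i \<in> I \<Longrightarrow> bounded_linear (\<phi> i)"
      "\<And>x. x = (\<Sum>i\<in>I. \<phi> i x *\<^sub>R \<beta> i)"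
    and p: "\<And>x. (p x has_vector_derivative p' x) (at 0)" "\<And>x. p x 0 = x"
    and T: "\<forall>\<^sub>F r in nhds 0. \<forall>l. length l = n \<longrightarrow> (\<forall>i<n. linear (\<lambda>x. T r (l[i := x])))"
      "\<And>l. length l = n \<Longrightarrow> ((\<lambda>r. T r l) has_real_derivative D l) (at 0)"
    and l: "length l = n"
  shows "((\<lambda>r. T r (map (\<lambda>x. p x r) l)) has_real_derivative
    D l + (\<Sum>i<n. T 0 (l[i := p' (l ! i)]))) (at 0)"
  using T l
proof (induction l arbitrary: T D n)
  case Nil
  then show ?case by simp
next
  case (Cons x l)
  define m where "m = length l"
  have n: "n = Suc m"
    using Cons.prems(3) by (simp add: m_def)
  let ?T = "\<lambda>r l. T r (p x r # l)" and ?D = "\<lambda>l. D (x # l) + T 0 (p' x # l)"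
  have "((\<lambda>r. ?T r (map (\<lambda>x. p x r) l)) has_real_derivative
    ?D l + (\<Sum>i<m. ?T 0 (l[i := p' (l ! i)]))) (at 0)"
  proof (rule Cons.IH)
    show "length l = m" by (simp add: m_def)
    show "\<forall>\<^sub>F r in nhds 0. \<forall>l. length l = m \<longrightarrow> (\<forall>i<m. linear (\<lambda>y. ?T r (l[i := y])))"
      using Cons.prems(1)
    proof eventually_elim
      case (elim r)
      show ?case
      proof (intro allI impI)
        fix l :: "'v list" and i assume "length l = m" "i < m"
        then show "linear (\<lambda>y. ?T r (l[i := y]))"
          using elim[rule_format, of "p x r # l" "Suc i"] n by simp
      qed
    qed
    fix l :: "'v list" assume l: "length l = m"
    have ev: "\<forall>\<^sub>F r in nhds 0. T r (y r # l) = (\<Sum>i\<in>I. \<phi> i (y r) * T r (\<beta> i # l))"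
      for y :: "real \<Rightarrow> 'v"
      using Cons.prems(1)
    proof eventually_elim
      case (elim r)
      \<comment> \<open>the entry in slot \<open>0\<close> is arbitrary, as the update overwrites it\<close>
      have L: "linear (\<lambda>y. T r (y # l))"
          using elim[rule_format, of "undefined # l" 0] l n by simp
      have "T r (y r # l) = T r ((\<Sum>i\<in>I. \<phi> i (y r) *\<^sub>R \<beta> i) # l)"
        by (subst I(3)[of "y r"]) simp
      also have "\<dots> = (\<Sum>i\<in>I. \<phi> i (y r) * T r (\<beta> i # l))"
        by (simp add: linear_sum[OF L] linear_scale[OF L])
      finally show ?case .
    qed
    have D\<beta>: "((\<lambda>r. T r (\<beta> i # l)) has_real_derivative D (\<beta> i # l)) (at 0)" for i
      using Cons.prems(2) l n by simp
    have D\<phi>: "((\<lambda>r. \<phi> i (y r)) has_real_derivative \<phi> i y') (at 0)"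
      if "(y has_vector_derivative y') (at 0)" "i \<in> I" for y y' i
      using bounded_linear.has_vector_derivative[OF I(2)[OF that(2)] that(1)]
      by (simp add: has_real_derivative_iff_has_vector_derivative)
    have *: "((\<lambda>r. T r (y r # l)) has_real_derivative
        (\<Sum>i\<in>I. \<phi> i y' * T 0 (\<beta> i # l) + D (\<beta> i # l) * \<phi> i (y 0))) (at 0)"
      if "(y has_vector_derivative y') (at 0)" for y y'
    proof -
      have "((\<lambda>r. \<Sum>i\<in>I. \<phi> i (y r) * T r (\<beta> i # l)) has_real_derivative
          (\<Sum>i\<in>I. \<phi> i y' * T 0 (\<beta> i # l) + D (\<beta> i # l) * \<phi> i (y 0))) (at 0)"
        by (intro DERIV_sum DERIV_mult D\<phi> D\<beta> that)
      then show ?thesis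
        by (subst DERIV_cong_ev[OF refl ev refl])
    qed
    have "((\<lambda>r. T r (x # l)) has_real_derivative D (x # l)) (at 0)"
      using Cons.prems(2) l n by simp
    from DERIV_unique[OF this *[of "\<lambda>r. x" 0]]
    have Dx: "D (x # l) = (\<Sum>i\<in>I. D (\<beta> i # l) * \<phi> i x)"
      using I(2) by (simp add: linear_simps cong: sum.cong)
    have Tx: "T 0 (p' x # l) = (\<Sum>i\<in>I. \<phi> i (p' x) * T 0 (\<beta> i # l))"
      using eventually_nhds_x_imp_x[OF ev[of "\<lambda>_. p' x"]] .
    show "((\<lambda>r. ?T r l) has_real_derivative ?D l) (at 0)"
      using *[OF p(1)[of x]] by (simp add: Dx Tx p(2) sum.distrib add.commute)
  qed
  then show ?case
    by (simp add: n p(2) sum.lessThan_Suc_shift add.assoc del: sum.lessThan_Suc)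
qed

lemma blinfun_real_basis_expansion:
  fixes a :: "'e::euclidean_space \<Rightarrow>\<^sub>L real"
  shows "a = (\<Sum>b\<in>Basis. a b *\<^sub>R blinfun_inner_left b)"
proof (rule blinfun_eqI)
  fix x :: 'e
  have "a x = a (\<Sum>b\<in>Basis. (x \<bullet> b) *\<^sub>R b)"
    by (simp add: euclidean_representation)
  also have "\<dots> = (\<Sum>b\<in>Basis. a b *\<^sub>R blinfun_inner_left b) x"
    by (simp add: blinfun.sum_right blinfun.scaleR_right blinfun.sum_left blinfun.scaleR_left
        inner_commute mult.commute)
  finally show "a x = (\<Sum>b\<in>Basis. a b *\<^sub>R blinfun_inner_left b) x" .
qed

lemma has_vector_derivative_blinfun_real:
  fixes a :: "real \<Rightarrow> 'e::euclidean_space \<Rightarrow>\<^sub>L real" and a' :: "'e \<Rightarrow>\<^sub>L real"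
  assumes "\<And>w. ((\<lambda>r. a r w) has_real_derivative a' w) (at 0)"
  shows "(a has_vector_derivative a') (at 0)"
proof -
  have "((\<lambda>r. \<Sum>b\<in>Basis. a r b *\<^sub>R blinfun_inner_left b) has_vector_derivative
      (\<Sum>b\<in>Basis. a' b *\<^sub>R blinfun_inner_left b :: 'e \<Rightarrow>\<^sub>L real)) (at 0)"
    by (auto intro!: derivative_eq_intros assms has_vector_derivative_sum)
  then show ?thesis
    by (simp only: blinfun_real_basis_expansion[symmetric])
qed

text \<open>The moving covectors need only be differentiable after evaluation at each vector; in finite
  dimension this is the same as differentiability, and it is the form in which transported covectors
  are obtained.\<close>

lemma has_real_derivative_tensor:
  fixes g :: "real \<Rightarrow> ('e::euclidean_space \<Rightarrow>\<^sub>L real) list \<Rightarrow> 'e list \<Rightarrow> real"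
    and p :: "('e \<Rightarrow>\<^sub>L real) \<Rightarrow> real \<Rightarrow> ('e \<Rightarrow>\<^sub>L real)"
    and p' :: "('e \<Rightarrow>\<^sub>L real) \<Rightarrow> ('e \<Rightarrow>\<^sub>L real)"
  assumes g: "\<forall>\<^sub>F r in nhds 0. multilinear h k (g r)"
      "\<And>as vs. length as = h \<Longrightarrow> length vs = k \<Longrightarrow>
        ((\<lambda>r. g r as vs) has_real_derivative D as vs) (at 0)"
    and P: "\<And>a w. ((\<lambda>r. p a r w) has_real_derivative p' a w) (at 0)" "\<And>a. p a 0 = a"
    and Q: "\<And>v. (q v has_vector_derivative q' v) (at 0)" "\<And>v. q v 0 = v"
    and as: "length as = h" and vs: "length vs = k"
  shows "((\<lambda>r. g r (map (\<lambda>a. p a r) as) (map (\<lambda>v. q v r) vs)) has_real_derivative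
    D as vs + (\<Sum>j<k. g 0 as (vs[j := q' (vs ! j)])) + (\<Sum>i<h. g 0 (as[i := p' (as ! i)]) vs)) (at 0)"
proof -
  have 1: "((\<lambda>r. g r as (map (\<lambda>v. q v r) vs)) has_real_derivative
      D as vs + (\<Sum>j<k. g 0 as (vs[j := q' (vs ! j)]))) (at 0)" if as: "length as = h" for as
  proof (rule has_real_derivative_multilinear_list[where I = Basis and \<phi> = "\<lambda>b x. x \<bullet> b"
        and \<beta> = "\<lambda>b. b" and T = "\<lambda>r. g r as" and D = "D as", OF _ _ _ Q])
    show "\<forall>\<^sub>F r in nhds 0. \<forall>l. length l = k \<longrightarrow> (\<forall>i<k. linear (\<lambda>x. g r as (l[i := x])))"
      using g(1) by eventually_elim (simp add: multilinear_def as)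
  qed (use as vs g(2) in \<open>simp_all add: euclidean_representation bounded_linear_inner_left\<close>)
  have "((\<lambda>r. (\<lambda>r as. g r as (map (\<lambda>v. q v r) vs)) r (map (\<lambda>a. p a r) as)) has_real_derivative
    (\<lambda>as. D as vs + (\<Sum>j<k. g 0 as (vs[j := q' (vs ! j)]))) as +
    (\<Sum>i<h. (\<lambda>r as. g r as (map (\<lambda>v. q v r) vs)) 0 (as[i := p' (as ! i)]))) (at 0)"
  proof (rule has_real_derivative_multilinear_list[where I = Basis and \<phi> = "\<lambda>b a. blinfun_apply a b"
        and \<beta> = blinfun_inner_left, OF _ _ _ has_vector_derivative_blinfun_real[OF P(1)] P(2)])
    show "\<forall>\<^sub>F r in nhds 0. \<forall>l. length l = h \<longrightarrow>
        (\<forall>i<h. linear (\<lambda>x. g r (l[i := x]) (map (\<lambda>v. q v r) vs)))"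
      using g(1) by eventually_elim (simp add: multilinear_def vs)
  qed (use 1 as in \<open>simp_all add: blinfun_real_basis_expansion[symmetric] blinfun.bounded_linear_left\<close>)
  then show ?thesis
    by (simp add: Q(2))
qed


section \<open>Periodic solutions of nilpotent linear equations are constant\<close>

text \<open>The equation says that \<open>f' = B \<cdot> f\<close> for the action of \<open>B\<close> on tensors, which is nilpotent.  Its solutions
  are polynomials in \<open>r\<close>, and a periodic polynomial is constant.  The proof is by induction on the number
  of arguments that \<open>B\<close> does not kill: as \<open>B\<^sup>2 = 0\<close>, each term of \<open>f'\<close> has one such argument less, so by
  induction \<open>f'\<close> is a constant \<open>c\<close>, and \<open>f 1 = f 0\<close> forces \<open>c = 0\<close>.\<close>

lemma nilpotent_periodic_constant:
  fixes f :: "real \<Rightarrow> ('e::euclidean_space \<Rightarrow>\<^sub>L real) list \<Rightarrow> 'e list \<Rightarrow> real"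
    and B :: "'e \<Rightarrow>\<^sub>L 'e"
  assumes B: "B o\<^sub>L B = 0"
    and ml: "\<And>r. multilinear h k (f r)"
    and deriv: "\<And>r as vs. length as = h \<Longrightarrow> length vs = k \<Longrightarrow>
      ((\<lambda>r. f r as vs) has_real_derivative
        (\<Sum>i<h. f r (as[i := as ! i o\<^sub>L B]) vs) - (\<Sum>j<k. f r as (vs[j := B (vs ! j)]))) (at r)"
    and per: "\<And>as vs. length as = h \<Longrightarrow> length vs = k \<Longrightarrow> f 1 as vs = f 0 as vs"
    and as: "length as = h" and vs: "length vs = k"
  shows "f r as vs = f 0 as vs"
  using as vs
proof (induction "card {i\<in>{..<h}. as ! i o\<^sub>L B \<noteq> 0} + card {j\<in>{..<k}. B (vs ! j) \<noteq> 0}"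
    arbitrary: as vs r rule: less_induct)
  case (less as vs)
  have BB: "B (B w) = 0" for w
    using B by (metis blinfun_apply_blinfun_compose zero_blinfun.rep_eq)
  let ?A = "\<lambda>as. {i\<in>{..<h}. as ! i o\<^sub>L B \<noteq> 0}" and ?V = "\<lambda>vs. {j\<in>{..<k}. B (vs ! j) \<noteq> 0}"
  have A: "f r (as[i := as ! i o\<^sub>L B]) vs = f 0 (as[i := as ! i o\<^sub>L B]) vs" if i: "i < h" for i r
  proof (cases "as ! i o\<^sub>L B = 0")
    case True
    have "linear (\<lambda>a. f r (as[i := a]) vs)" for r
      using ml[of r] less.prems i by (simp add: multilinear_def)
    from linear_0[OF this, of r] linear_0[OF this, of 0] show ?thesis
      by (simp add: True)
  next
    case False
    have "as ! i o\<^sub>L B o\<^sub>L B = 0"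
      by (rule blinfun_eqI) (simp add: BB)
    then have eq: "?A (as[i := as ! i o\<^sub>L B]) = ?A as - {i}"
      using less.prems i by (auto simp: nth_list_update split: if_splits)
    have "i \<in> ?A as"
      using i False by simp
    then have "card (?A (as[i := as ! i o\<^sub>L B])) < card (?A as)"
      unfolding eq by (intro card_Diff1_less) auto
    then show ?thesis
      using less.prems by (intro less.hyps) auto
  qed
  have V: "f r as (vs[j := B (vs ! j)]) = f 0 as (vs[j := B (vs ! j)])" if j: "j < k" for j r
  proof (cases "B (vs ! j) = 0")
    case True
    have "linear (\<lambda>v. f r as (vs[j := v]))" for r
      using ml[of r] less.prems j by (simp add: multilinear_def)
    from linear_0[OF this, of r] linear_0[OF this, of 0] show ?thesis
      by (simp add: True)
  next
    case False
    have eq: "?V (vs[j := B (vs ! j)]) = ?V vs - {j}"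
      using less.prems j by (auto simp: nth_list_update BB split: if_splits)
    have "j \<in> ?V vs"
      using j False by simp
    then have "card (?V (vs[j := B (vs ! j)])) < card (?V vs)"
      unfolding eq by (intro card_Diff1_less) auto
    then show ?thesis
      using less.prems by (intro less.hyps) auto
  qed
  define c where "c = (\<Sum>i<h. f 0 (as[i := as ! i o\<^sub>L B]) vs) - (\<Sum>j<k. f 0 as (vs[j := B (vs ! j)]))"
  have "((\<lambda>r. f r as vs) has_real_derivative c) (at r)" for r
    using deriv[OF less.prems, of r] A[of _ r] V[of _ r] by (simp add: c_def)
  then have "((\<lambda>r. f r as vs - c * r) has_real_derivative 0) (at r)" for r
    by (auto intro!: derivative_eq_intros)
  then have const: "f r as vs - c * r = f 0 as vs - c * 0" for r
    using DERIV_isconst_all by blast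
  from const[of 1] have "c = 0"
    using per[OF less.prems] by simp
  then show ?case
    using const[of r] by simp
qed


section \<open>Calculus in charts\<close>

lemma smooth_on_differentiable:
  assumes "smooth_on S f" "x \<in> S" shows "f differentiable (at x)"
proof -
  have "Ck_on (Suc 0) S f"
    using assms(1) unfolding smooth_on_def by blast
  then show ?thesis
    using assms(2) by simp
qed

lemma smooth_on_frechet_derivative:
  assumes "smooth_on S f" shows "smooth_on S (\<lambda>x. frechet_derivative f (at x) v)"
  unfolding smooth_on_def
proof
  fix n
  have "Ck_on (Suc n) S f"
    using assms unfolding smooth_on_def by blast
  then show "Ck_on n S (\<lambda>x. frechet_derivative f (at x) v)"
    by simp
qed

lemma Dmap_apply: "f differentiable (at x) \<Longrightarrow> Dmap f x v = frechet_derivative f (at x) v"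
  by (simp add: Dmap_def bounded_linear_Blinfun_apply frechet_derivative_works
      has_derivative_bounded_linear)

lemma has_derivative_Dmap: "f differentiable (at x) \<Longrightarrow> (f has_derivative Dmap f x) (at x)"
  by (simp add: Dmap_def bounded_linear_Blinfun_apply frechet_derivative_works
      has_derivative_bounded_linear)

lemma Dmap_eqI:
  assumes "(f has_derivative blinfun_apply D) (at x)" shows "Dmap f x = D"
  by (simp add: Dmap_def frechet_derivative_at[OF assms, symmetric] blinfun_apply_inverse)

lemma Dmap_cong_open:
  assumes "open S" "x \<in> S" "\<And>y. y \<in> S \<Longrightarrow> f y = g y"
  shows "Dmap f x = Dmap g x"
  using frechet_derivative_cong_open[OF assms] by (simp add: Dmap_def)

lemma has_vector_derivative_compose_derivative:
  assumes "(g has_vector_derivative g') (at r)" and "(f has_derivative f') (at (g r))"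
  shows "((\<lambda>r. f (g r)) has_vector_derivative f' g') (at r)"
proof -
  have "linear f'" using assms(2) by (rule has_derivative_linear)
  with diff_chain_at[OF assms(1)[unfolded has_vector_derivative_def] assms(2)] show ?thesis
    by (simp add: has_vector_derivative_def o_def linear_scale)
qed

lemma has_derivative_slice:
  assumes "(f has_derivative f') (at (a, b))"
  shows "((\<lambda>u. f (a, u)) has_derivative (\<lambda>w. f' (0, w))) (at b)"
proof -
  have "((\<lambda>u. (a, u)) has_derivative (\<lambda>w. (0, w))) (at b)"
    by (auto intro!: derivative_eq_intros)
  from has_derivative_compose[OF this assms] show ?thesis .
qed

text \<open>In the product rule the derivative of \<open>M\<close> is paired with \<open>Y x = 0\<close>.  In this way second derivatives drop
  out whenever an identity between vector fields is differentiated at a common zero.\<close>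

lemma has_derivative_linear_family_vanishing:
  fixes M :: "'a::real_normed_vector \<Rightarrow> 'e::euclidean_space \<Rightarrow> 'b::real_normed_vector"
  assumes S: "open S" "x \<in> S" "\<And>u. u \<in> S \<Longrightarrow> linear (M u)"
    and M: "\<And>b. (\<lambda>u. M u b) differentiable (at x)"
    and Y: "(Y has_derivative Y') (at x)" "Y x = 0"
  shows "((\<lambda>u. M u (Y u)) has_derivative (\<lambda>w. M x (Y' w))) (at x)"
proof -
  have expand: "M u y = (\<Sum>b\<in>Basis. (y \<bullet> b) *\<^sub>R M u b)" if "u \<in> S" for u y
  proof -
    have "M u y = M u (\<Sum>b\<in>Basis. (y \<bullet> b) *\<^sub>R b)"
      by (simp add: euclidean_representation)
    then show ?thesis
      by (simp add: linear_sum[OF S(3)[OF that]] linear_scale[OF S(3)[OF that]])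
  qed
  have "((\<lambda>u. (Y u \<bullet> b) *\<^sub>R M u b) has_derivative
      (\<lambda>w. (Y x \<bullet> b) *\<^sub>R frechet_derivative (\<lambda>u. M u b) (at x) w + (Y' w \<bullet> b) *\<^sub>R M x b)) (at x)"
    for b
    by (intro has_derivative_scaleR has_derivative_inner_left Y(1) M[unfolded frechet_derivative_works])
  then have "((\<lambda>u. (Y u \<bullet> b) *\<^sub>R M u b) has_derivative (\<lambda>w. (Y' w \<bullet> b) *\<^sub>R M x b)) (at x)" for b
    by (simp add: Y(2))
  then have "((\<lambda>u. \<Sum>b\<in>Basis. (Y u \<bullet> b) *\<^sub>R M u b) has_derivative
      (\<lambda>w. \<Sum>b\<in>Basis. (Y' w \<bullet> b) *\<^sub>R M x b)) (at x)"
    by (rule has_derivative_sum)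
  then have "((\<lambda>u. M u (Y u)) has_derivative (\<lambda>w. \<Sum>b\<in>Basis. (Y' w \<bullet> b) *\<^sub>R M x b)) (at x)"
    by (rule has_derivative_transform_within_open[OF _ S(1,2)]) (simp add: expand)
  then show ?thesis
    unfolding expand[OF S(2), symmetric] .
qed

locale atlas =
  fixes A :: "('m::topological_space, 'e::euclidean_space) chart set"
  assumes atlas: "smooth_atlas A"
begin

lemma chart:
  assumes "c \<in> A"
  shows open_cdom: "open (cdom c)"
    and homeomorphism_chart: "homeomorphism (cdom c) (cmap c ` cdom c) (cmap c) (cinv c)"
    and open_chart_image: "open (cmap c ` cdom c)"
  using atlas assms by (auto simp: smooth_atlas_def is_chart_def)

lemma cinv_cmap [simp]: "c \<in> A \<Longrightarrow> x \<in> cdom c \<Longrightarrow> cinv c (cmap c x) = x"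
  using homeomorphism_chart by (rule homeomorphism_apply1)

lemma open_cmap_image:
  assumes c: "c \<in> A" and V: "open V"
  shows "open (cmap c ` (cdom c \<inter> V))"
proof -
  have "openin (top_of_set (cmap c ` cdom c)) (cmap c ` (cdom c \<inter> V))"
    by (rule homeomorphism_imp_open_map[OF homeomorphism_chart[OF c]])
       (use V in \<open>auto simp: openin_open\<close>)
  then show ?thesis
    using openin_open_trans open_chart_image[OF c] by blast
qed

lemma chart_at: obtains c where "c \<in> A" "x \<in> cdom c"
proof -
  have "x \<in> (\<Union>c\<in>A. cdom c)"
    using atlas unfolding smooth_atlas_def by blast
  then show thesis
    using that by blast
qed

end


section \<open>Local calculus of a smooth torus action\<close>

locale smooth_torus_action = atlas A
  for A :: "('m::topological_space, 'e::euclidean_space) chart set" +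
  fixes U :: "'m set" and \<rho> :: "real ^ 'p::finite \<Rightarrow> 'm \<Rightarrow> 'm"
  assumes open_U: "open U" and action: "torus_action A U \<rho>"
begin

lemma act_in [simp]: "x \<in> U \<Longrightarrow> \<rho> t x \<in> U"
  and act_zero [simp]: "x \<in> U \<Longrightarrow> \<rho> 0 x = x"
  and act_add: "x \<in> U \<Longrightarrow> \<rho> (s + t) x = \<rho> s (\<rho> t x)"
  and act_lattice: "t \<in> integer_lattice \<Longrightarrow> x \<in> U \<Longrightarrow> \<rho> t x = x"
  using action by (auto simp: torus_action_def)

lemma act_minus [simp]: "x \<in> U \<Longrightarrow> \<rho> (- t) (\<rho> t x) = x"
  using act_add[of x "- t" t] by simp

lemma act_commute: "x \<in> U \<Longrightarrow> \<rho> s (\<rho> t x) = \<rho> t (\<rho> s x)"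
  by (metis act_add add.commute)

text \<open>Time and space are kept together in one map, so that derivatives in both can be exchanged.  Outside
  \<open>act_dom c d\<close> the values are meaningless.\<close>

definition act_chart :: "('m, 'e) chart \<Rightarrow> ('m, 'e) chart \<Rightarrow> (real ^ 'p) \<times> 'e \<Rightarrow> 'e" where
  "act_chart c d = (\<lambda>(t, u). cmap d (\<rho> t (cinv c u)))"

definition act_dom :: "('m, 'e) chart \<Rightarrow> ('m, 'e) chart \<Rightarrow> ((real ^ 'p) \<times> 'e) set" where
  "act_dom c d = {(t, u). u \<in> cmap c ` (cdom c \<inter> U) \<and> \<rho> t (cinv c u) \<in> cdom d}"

lemma smooth_act_chart: "c \<in> A \<Longrightarrow> d \<in> A \<Longrightarrow> smooth_on (act_dom c d) (act_chart c d)"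
  using action by (auto simp: torus_action_def act_chart_def act_dom_def)

lemma act_domI:
  "c \<in> A \<Longrightarrow> x \<in> U \<Longrightarrow> x \<in> cdom c \<Longrightarrow> \<rho> t x \<in> cdom d \<Longrightarrow> (t, cmap c x) \<in> act_dom c d"
  by (auto simp: act_dom_def)

lemma act_domE:
  assumes "c \<in> A" "(t, u) \<in> act_dom c d"
  obtains x where "x \<in> U" "x \<in> cdom c" "\<rho> t x \<in> cdom d" "u = cmap c x" "cinv c u = x"
  using assms by (auto simp: act_dom_def)

lemma open_act_dom:
  assumes c: "c \<in> A" and d: "d \<in> A"
  shows "open (act_dom c d)"
proof -
  let ?V = "cmap c ` (cdom c \<inter> U)"
  have V: "open ?V"
    using c open_U by (rule open_cmap_image)
  have inv: "continuous_on ?V (cinv c)"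
    using homeomorphism_cont2[OF homeomorphism_chart[OF c]]
    by (rule continuous_on_subset) auto
  have pair: "continuous_on (UNIV \<times> ?V) (\<lambda>p. (fst p, cinv c (snd p)))"
    by (intro continuous_intros continuous_on_compose2[OF inv]) auto
  have act: "continuous_on (UNIV \<times> U) (\<lambda>(t, x). \<rho> t x)"
    using action by (simp add: torus_action_def)
  have "(\<lambda>p. (fst p, cinv c (snd p))) ` (UNIV \<times> ?V) \<subseteq> (UNIV :: (real ^ 'p) set) \<times> U"
    using c by (auto simp only: image_subset_iff mem_Sigma_iff snd_conv fst_conv cinv_cmap
        Int_iff UNIV_I image_iff)
  from continuous_on_compose2[OF act pair this]
  have "continuous_on (UNIV \<times> ?V) (\<lambda>(t, u). \<rho> t (cinv c u))"
    by (simp only: case_prod_unfold fst_conv snd_conv)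
  from continuous_open_preimage[OF this open_Times[OF open_UNIV V] open_cdom[OF d]]
  show ?thesis
    by (rule back_subst[of "open"]) (auto simp: act_dom_def)
qed

lemma open_act_dom_slice:
  assumes "c \<in> A" "d \<in> A" shows "open {u. (t, u) \<in> act_dom c d}"
  using open_vimage[OF open_act_dom[OF assms], of "Pair t"]
  by (simp add: vimage_def continuous_on_Pair)

lemma open_act_dom_line:
  assumes "c \<in> A" "d \<in> A" shows "open {r::real. (t + r *\<^sub>R v, u) \<in> act_dom c d}"
proof -
  have "continuous_on UNIV (\<lambda>r::real. (t + r *\<^sub>R v, u))"
    by (intro continuous_intros)
  from open_vimage[OF open_act_dom[OF assms] this] show ?thesis
    by (simp add: vimage_def)
qed

lemma act_chart_differentiable:
  "c \<in> A \<Longrightarrow> d \<in> A \<Longrightarrow> p \<in> act_dom c d \<Longrightarrow> act_chart c d differentiable (at p)"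
  using smooth_act_chart smooth_on_differentiable by blast

lemma has_derivative_act_chart:
  "c \<in> A \<Longrightarrow> d \<in> A \<Longrightarrow> p \<in> act_dom c d \<Longrightarrow>
    (act_chart c d has_derivative frechet_derivative (act_chart c d) (at p)) (at p)"
  using act_chart_differentiable frechet_derivative_works by blast

lemma has_derivative_tangent_map:
  assumes c: "c \<in> A" and d: "d \<in> A" and x: "x \<in> U" "x \<in> cdom c" "\<rho> t x \<in> cdom d"
  shows "((\<lambda>u. act_chart c d (t, u)) has_derivative tangent_map c d (\<rho> t) x) (at (cmap c x))"
    and "tangent_map c d (\<rho> t) x w = frechet_derivative (act_chart c d) (at (t, cmap c x)) (0, w)"
proof -
  have "((\<lambda>u. act_chart c d (t, u)) has_derivative
      (\<lambda>w. frechet_derivative (act_chart c d) (at (t, cmap c x)) (0, w))) (at (cmap c x))"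
    by (rule has_derivative_slice[OF has_derivative_act_chart[OF c d act_domI[OF c x]]])
  note D = this
  have eq: "cmap d \<circ> \<rho> t \<circ> cinv c = (\<lambda>u. act_chart c d (t, u))"
    by (auto simp: act_chart_def)
  have diff: "(\<lambda>u. act_chart c d (t, u)) differentiable (at (cmap c x))"
    using D by (auto simp: differentiable_def)
  show "((\<lambda>u. act_chart c d (t, u)) has_derivative tangent_map c d (\<rho> t) x) (at (cmap c x))"
    unfolding tangent_map_def eq using diff by (rule has_derivative_Dmap)
  from fun_cong[OF has_derivative_unique[OF this D], of w]
  show "tangent_map c d (\<rho> t) x w = frechet_derivative (act_chart c d) (at (t, cmap c x)) (0, w)" .
qed

lemma tangent_map_eqI:
  assumes c: "c \<in> A" and x: "x \<in> U" "x \<in> cdom c"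
    and eq: "\<And>y. y \<in> U \<Longrightarrow> f y = g y"
  shows "tangent_map c d f x = tangent_map c d g x"
  unfolding tangent_map_def
  by (rule Dmap_cong_open[OF open_cmap_image[OF c open_U]]) (use c x eq in auto)

lemma tangent_map_act_zero:
  assumes c: "c \<in> A" and x: "x \<in> U" "x \<in> cdom c"
  shows "tangent_map c c (\<rho> 0) x = id_blinfun"
  unfolding tangent_map_def
proof (rule Dmap_eqI)
  have "((\<lambda>u. u) has_derivative id_blinfun) (at (cmap c x))"
    by (auto intro!: derivative_eq_intros)
  then show "(cmap c \<circ> \<rho> 0 \<circ> cinv c has_derivative id_blinfun) (at (cmap c x))"
    by (rule has_derivative_transform_within_open[OF _ open_cmap_image[OF c open_U]])
       (use c x in auto)
qed

text \<open>The chain rule, in the form of a cocycle identity.  For \<open>s = 0\<close> or \<open>t = 0\<close> it describes the change of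
  charts, since \<open>\<rho> 0\<close> is the identity on \<open>U\<close>.\<close>

lemma tangent_map_act_add:
  assumes c: "c \<in> A" and d: "d \<in> A" and e: "e \<in> A"
    and x: "x \<in> U" "x \<in> cdom c" "\<rho> t x \<in> cdom d" "\<rho> (s + t) x \<in> cdom e"
  shows "tangent_map c e (\<rho> (s + t)) x =
    tangent_map d e (\<rho> s) (\<rho> t x) o\<^sub>L tangent_map c d (\<rho> t) x"
  unfolding tangent_map_def[of c e]
proof (rule Dmap_eqI)
  have tx: "\<rho> t x \<in> U" "\<rho> s (\<rho> t x) \<in> cdom e"
    using x act_add by auto
  have "((\<lambda>u. act_chart d e (s, u)) has_derivative tangent_map d e (\<rho> s) (\<rho> t x))
      (at (act_chart c d (t, cmap c x)))"
    using has_derivative_tangent_map(1)[OF d e tx(1) x(3) tx(2)] c x by (simp add: act_chart_def)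
  from has_derivative_compose[OF has_derivative_tangent_map(1)[OF c d x(1-3)] this]
  have "((\<lambda>u. act_chart d e (s, act_chart c d (t, u))) has_derivative
      (tangent_map d e (\<rho> s) (\<rho> t x) o\<^sub>L tangent_map c d (\<rho> t) x)) (at (cmap c x))"
    by (simp add: blinfun_compose.rep_eq o_def)
  then show "(cmap e \<circ> \<rho> (s + t) \<circ> cinv c has_derivative
      (tangent_map d e (\<rho> s) (\<rho> t x) o\<^sub>L tangent_map c d (\<rho> t) x)) (at (cmap c x))"
  proof (rule has_derivative_transform_within_open[OF _ open_act_dom_slice[OF c d]])
    show "cmap c x \<in> {u. (t, u) \<in> act_dom c d}"
      using c x by (simp add: act_domI)
    fix u assume "u \<in> {u. (t, u) \<in> act_dom c d}"
    then have "(t, u) \<in> act_dom c d" by simp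
    with c obtain z where "z \<in> U" "z \<in> cdom c" "\<rho> t z \<in> cdom d" "u = cmap c z"
      by (rule act_domE)
    then show "act_chart d e (s, act_chart c d (t, u)) = (cmap e \<circ> \<rho> (s + t) \<circ> cinv c) u"
      using c d by (simp add: act_chart_def act_add)
  qed
qed

text \<open>The field \<open>Z\<^sub>v\<close> of velocities at \<open>r = 0\<close> of the curves \<open>r \<mapsto> \<rho> (r v) x\<close>, as a time derivative of the
  action.\<close>

definition generator :: "real ^ 'p \<Rightarrow> ('m, 'e) vfield" where
  "generator v c x = frechet_derivative (act_chart c c) (at (0, cmap c x)) (v, 0)"

context
  fixes c :: "('m, 'e) chart" and x :: 'm and v :: "real ^ 'p"
  assumes c: "c \<in> A" and x: "x \<in> U" "x \<in> cdom c"
begin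

lemma base_in_act_dom: "(0, cmap c x) \<in> act_dom c c"
  using c x by (simp add: act_domI)

lemma open_line: "open {r::real. (r *\<^sub>R v, cmap c x) \<in> act_dom c c}"
  using open_act_dom_line[OF c c, of 0] by simp

lemma line_in_dom: "(r *\<^sub>R v, cmap c x) \<in> act_dom c c \<longleftrightarrow> \<rho> (r *\<^sub>R v) x \<in> cdom c"
  using c x by (auto simp: act_dom_def)

lemma generator_curve:
  "((\<lambda>r. act_chart c c (r *\<^sub>R v, cmap c x)) has_vector_derivative generator v c x) (at 0)"
proof -
  have "((\<lambda>r. (r *\<^sub>R v, cmap c x)) has_vector_derivative (v, 0)) (at 0)"
    unfolding has_vector_derivative_def by (auto intro!: derivative_eq_intros)
  then show ?thesis
    unfolding generator_def
    by (rule has_vector_derivative_compose_derivative)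
       (use has_derivative_act_chart[OF c c base_in_act_dom] in simp)
qed

end

context
  fixes c :: "('m, 'e) chart" and x :: 'm and v :: "real ^ 'p"
  assumes c: "c \<in> A" and x: "x \<in> U" "x \<in> cdom c"
begin

lemma has_vector_derivative_along_generator:
  assumes "(f has_derivative f') (at (cmap c x))"
  shows "((\<lambda>r. f (cmap c (\<rho> (r *\<^sub>R v) x))) has_vector_derivative f' (generator v c x)) (at 0)"
proof -
  have "act_chart c c (0 *\<^sub>R v, cmap c x) = cmap c x"
    using c x by (simp add: act_chart_def)
  with assms have "((\<lambda>r. f (act_chart c c (r *\<^sub>R v, cmap c x))) has_vector_derivative
      f' (generator v c x)) (at 0)"
    by (intro has_vector_derivative_compose_derivative[OF generator_curve[OF c x]]) simp
  then show ?thesis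
    using c x by (simp add: act_chart_def)
qed

lemma has_derivative_generator:
  "((generator v c \<circ> cinv c) has_derivative vf_jacobian c (generator v) x) (at (cmap c x))"
  and vf_jacobian_generator: "vf_jacobian c (generator v) x w =
    frechet_derivative (\<lambda>p. frechet_derivative (act_chart c c) (at p) (v, 0)) (at (0, cmap c x)) (0, w)"
proof -
  let ?L = "\<lambda>p. frechet_derivative (act_chart c c) (at p) (v, 0)"
  have "(?L has_derivative frechet_derivative ?L (at (0, cmap c x))) (at (0, cmap c x))"
    using smooth_on_differentiable[OF smooth_on_frechet_derivative[OF smooth_act_chart[OF c c]]
        base_in_act_dom[OF c x]]
    by (simp add: frechet_derivative_works)
  then have "((\<lambda>u. ?L (0, u)) has_derivative (\<lambda>w. frechet_derivative ?L (at (0, cmap c x)) (0, w)))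
      (at (cmap c x))"
    by (rule has_derivative_slice)
  then have D: "((generator v c \<circ> cinv c) has_derivative
      (\<lambda>w. frechet_derivative ?L (at (0, cmap c x)) (0, w))) (at (cmap c x))"
  proof (rule has_derivative_transform_within_open[OF _ open_cmap_image[OF c open_U]])
    show "cmap c x \<in> cmap c ` (cdom c \<inter> U)" using x by auto
  qed (use c in \<open>auto simp: generator_def\<close>)
  then have "(generator v c \<circ> cinv c) differentiable (at (cmap c x))"
    by (auto simp: differentiable_def)
  from has_derivative_Dmap[OF this]
  show D': "((generator v c \<circ> cinv c) has_derivative vf_jacobian c (generator v) x) (at (cmap c x))"
    by (simp add: vf_jacobian_def)
  show "vf_jacobian c (generator v) x w = frechet_derivative ?L (at (0, cmap c x)) (0, w)"
    by (rule fun_cong[OF has_derivative_unique[OF D' D]])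
qed

text \<open>The variational equation \<open>d/dr (T\<rho>\<^sub>r\<^sub>v w) = DZ\<^sub>v w\<close> at \<open>r = 0\<close>.  It is the symmetry of the second
  derivatives of the action in time and space.\<close>

lemma second_derivative_time:
  "frechet_derivative (\<lambda>p. frechet_derivative (act_chart c c) (at p) (0, w)) (at (0, cmap c x)) (v, 0) =
    vf_jacobian c (generator v) x w"
  unfolding vf_jacobian_generator
  by (rule frechet_derivative_symmetric[OF open_act_dom[OF c c] base_in_act_dom[OF c x] smooth_act_chart[OF c c]])

text \<open>The differential of \<open>\<rho>\<^sub>0 = id\<close> does not vary with the point.\<close>

lemma second_derivative_space:
  "frechet_derivative (\<lambda>p. frechet_derivative (act_chart c c) (at p) (0, w)) (at (0, cmap c x)) (0, z) = 0"
proof -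
  let ?K = "\<lambda>p. frechet_derivative (act_chart c c) (at p) (0, w)"
  have "(?K has_derivative frechet_derivative ?K (at (0, cmap c x))) (at (0, cmap c x))"
    using smooth_on_differentiable[OF smooth_on_frechet_derivative[OF smooth_act_chart[OF c c]]
        base_in_act_dom[OF c x]]
    by (simp add: frechet_derivative_works)
  then have D: "((\<lambda>u. ?K (0, u)) has_derivative (\<lambda>z. frechet_derivative ?K (at (0, cmap c x)) (0, z)))
      (at (cmap c x))"
    by (rule has_derivative_slice)
  have "((\<lambda>u. w) has_derivative (\<lambda>z. 0)) (at (cmap c x))"
    by simp
  then have "((\<lambda>u. ?K (0, u)) has_derivative (\<lambda>z. 0)) (at (cmap c x))"
  proof (rule has_derivative_transform_within_open[OF _ open_cmap_image[OF c open_U]])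
    show "cmap c x \<in> cmap c ` (cdom c \<inter> U)" using x by auto
    fix u assume "u \<in> cmap c ` (cdom c \<inter> U)"
    then obtain y where y: "u = cmap c y" "y \<in> U" "y \<in> cdom c" by auto
    then show "w = ?K (0, u)"
      using has_derivative_tangent_map(2)[OF c c y(2,3), of 0 w] tangent_map_act_zero[OF c y(2,3)]
      by simp
  qed
  from has_derivative_unique[OF D this] show ?thesis
    by (rule fun_cong)
qed

lemma tangent_map_act_derivative:
  "((\<lambda>r. tangent_map c c (\<rho> (r *\<^sub>R v)) x w) has_vector_derivative vf_jacobian c (generator v) x w) (at 0)"
proof -
  let ?K = "\<lambda>p. frechet_derivative (act_chart c c) (at p) (0, w)"
  have K: "(?K has_derivative frechet_derivative ?K (at (0, cmap c x))) (at (0, cmap c x))"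
    using smooth_on_differentiable[OF smooth_on_frechet_derivative[OF smooth_act_chart[OF c c]]
        base_in_act_dom[OF c x]]
    by (simp add: frechet_derivative_works)
  have "((\<lambda>r. (r *\<^sub>R v, cmap c x)) has_vector_derivative (v, 0)) (at 0)"
    unfolding has_vector_derivative_def by (auto intro!: derivative_eq_intros)
  then have "((\<lambda>r. ?K (r *\<^sub>R v, cmap c x)) has_vector_derivative vf_jacobian c (generator v) x w) (at 0)"
    unfolding second_derivative_time[symmetric]
    by (rule has_vector_derivative_compose_derivative) (use K in simp)
  then show ?thesis
  proof (rule has_vector_derivative_transform_within_open[OF _ open_line[OF c x]])
    show "0 \<in> {r. (r *\<^sub>R v, cmap c x) \<in> act_dom c c}"
      using base_in_act_dom[OF c x] by simp
    fix r assume "r \<in> {r. (r *\<^sub>R v, cmap c x) \<in> act_dom c c}"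
    then have "\<rho> (r *\<^sub>R v) x \<in> cdom c" by (simp add: line_in_dom[OF c x])
    from has_derivative_tangent_map(2)[OF c c x this, of w]
    show "?K (r *\<^sub>R v, cmap c x) = tangent_map c c (\<rho> (r *\<^sub>R v)) x w" by simp
  qed
qed

text \<open>The inverse of \<open>T\<rho>\<^sub>r\<^sub>v\<close> is the differential of the action at time \<open>- r v\<close> and at the moving point
  \<open>\<rho>\<^sub>r\<^sub>v x\<close>.  The motion of the point does not contribute to the derivative at \<open>r = 0\<close>, by
  \<open>second_derivative_space\<close>, and the reversed time changes the sign.\<close>

lemma tangent_map_act_inverse_derivative:
  "((\<lambda>r. tangent_map c c (\<rho> (- (r *\<^sub>R v))) (\<rho> (r *\<^sub>R v) x) w) has_vector_derivative
    - vf_jacobian c (generator v) x w) (at 0)"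
proof -
  let ?K = "\<lambda>p. frechet_derivative (act_chart c c) (at p) (0, w)"
  let ?p = "(0, cmap c x)"
  have K: "(?K has_derivative frechet_derivative ?K (at ?p)) (at ?p)"
    using smooth_on_differentiable[OF smooth_on_frechet_derivative[OF smooth_act_chart[OF c c]]
        base_in_act_dom[OF c x]]
    by (simp add: frechet_derivative_works)
  interpret K: linear "frechet_derivative ?K (at ?p)"
    using K by (rule has_derivative_linear)
  have "frechet_derivative ?K (at ?p) (- v, generator v c x) =
      frechet_derivative ?K (at ?p) (- (v, 0) + (0, generator v c x))"
    by simp
  also have "\<dots> = - vf_jacobian c (generator v) x w"
    unfolding K.add K.neg second_derivative_time second_derivative_space by simp
  finally have J: "frechet_derivative ?K (at ?p) (- v, generator v c x) = - vf_jacobian c (generator v) x w" .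
  have 0: "act_chart c c (0, cmap c x) = cmap c x"
    using c x by (simp add: act_chart_def)
  have "((\<lambda>r. (- (r *\<^sub>R v), act_chart c c (r *\<^sub>R v, cmap c x))) has_vector_derivative
      (- v, generator v c x)) (at 0)"
  proof -
    have "((\<lambda>r. (- (r *\<^sub>R v), act_chart c c (r *\<^sub>R v, cmap c x))) has_derivative
        (\<lambda>r. (- (r *\<^sub>R v), r *\<^sub>R generator v c x))) (at 0)"
      by (intro has_derivative_Pair has_derivative_minus has_derivative_scaleR_left
          has_derivative_ident generator_curve[OF c x, unfolded has_vector_derivative_def])
    then show ?thesis
      by (simp add: has_vector_derivative_def)
  qed
  then have "((\<lambda>r. ?K (- (r *\<^sub>R v), act_chart c c (r *\<^sub>R v, cmap c x))) has_vector_derivative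
      - vf_jacobian c (generator v) x w) (at 0)"
    unfolding J[symmetric]
    by (rule has_vector_derivative_compose_derivative) (use K 0 in simp)
  then show ?thesis
  proof (rule has_vector_derivative_transform_within_open[OF _ open_line[OF c x]])
    show "0 \<in> {r. (r *\<^sub>R v, cmap c x) \<in> act_dom c c}"
      using base_in_act_dom[OF c x] by simp
    fix r assume "r \<in> {r. (r *\<^sub>R v, cmap c x) \<in> act_dom c c}"
    then have "\<rho> (r *\<^sub>R v) x \<in> cdom c" by (simp add: line_in_dom[OF c x])
    from has_derivative_tangent_map(2)[OF c c act_in[OF x(1)] this, of "- (r *\<^sub>R v)" w]
    show "?K (- (r *\<^sub>R v), act_chart c c (r *\<^sub>R v, cmap c x)) =
        tangent_map c c (\<rho> (- (r *\<^sub>R v))) (\<rho> (r *\<^sub>R v) x) w"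
      using c x by (simp add: act_chart_def)
  qed
qed

text \<open>The generators are invariant because the torus is commutative: both sides are the velocity at
  \<open>r = 0\<close> of the curve \<open>\<rho>\<^sub>t \<rho>\<^sub>r\<^sub>v x = \<rho>\<^sub>r\<^sub>v \<rho>\<^sub>t x\<close>.\<close>

lemma tangent_map_generator:
  assumes d: "d \<in> A" and tx: "\<rho> t x \<in> cdom d"
  shows "generator v d (\<rho> t x) = tangent_map c d (\<rho> t) x (generator v c x)"
proof -
  have "((\<lambda>r. act_chart c d (t, cmap c (\<rho> (r *\<^sub>R v) x))) has_vector_derivative
      tangent_map c d (\<rho> t) x (generator v c x)) (at 0)"
    using has_derivative_tangent_map(1)[OF c d x tx] by (rule has_vector_derivative_along_generator)
  then have "((\<lambda>r. act_chart d d (r *\<^sub>R v, cmap d (\<rho> t x))) has_vector_derivative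
      tangent_map c d (\<rho> t) x (generator v c x)) (at 0)"
  proof (rule has_vector_derivative_transform_within_open[OF _ open_line[OF c x]])
    show "0 \<in> {r. (r *\<^sub>R v, cmap c x) \<in> act_dom c c}"
      using base_in_act_dom[OF c x] by simp
    fix r assume "r \<in> {r. (r *\<^sub>R v, cmap c x) \<in> act_dom c c}"
    then have "\<rho> (r *\<^sub>R v) x \<in> cdom c" by (simp add: line_in_dom[OF c x])
    then show "act_chart c d (t, cmap c (\<rho> (r *\<^sub>R v) x)) = act_chart d d (r *\<^sub>R v, cmap d (\<rho> t x))"
      using c d x tx by (simp add: act_chart_def act_commute[OF x(1), of t "r *\<^sub>R v"])
  qed
  moreover have "((\<lambda>r. act_chart d d (r *\<^sub>R v, cmap d (\<rho> t x))) has_vector_derivative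
      generator v d (\<rho> t x)) (at 0)"
    using d act_in[OF x(1)] tx by (rule generator_curve)
  ultimately show ?thesis
    by (rule vector_derivative_unique_at[rotated])
qed

end

end


section \<open>Tensor fields transported by the action\<close>

lemma blinfun_compose_assoc: "(f o\<^sub>L g) o\<^sub>L h = f o\<^sub>L (g o\<^sub>L h)"
  by (rule blinfun_eqI) simp

locale tensor_with_torus_action = smooth_torus_action A U \<rho>
  for A :: "('m::topological_space, 'e::euclidean_space) chart set"
    and U :: "'m set" and \<rho> :: "real ^ 'p::finite \<Rightarrow> 'm \<Rightarrow> 'm" +
  fixes G :: "('m, 'e) tfield" and h k :: nat
  assumes tensor: "tensor_field A h k G"
begin

lemma multilinear_tensor: "c \<in> A \<Longrightarrow> x \<in> cdom c \<Longrightarrow> multilinear h k (G c x)"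
  using tensor by (simp add: tensor_field_def)

text \<open>As \<open>\<rho> 0\<close> is the identity on \<open>U\<close>, this is the transformation law of \<open>G\<close> under changes of charts.\<close>

lemma tensor_preserved_zero: "tensor_preserved A h k U (\<rho> 0) G"
  unfolding tensor_preserved_def
proof (intro ballI impI allI)
  fix c d x as vs
  assume c: "c \<in> A" and d: "d \<in> A" and x: "x \<in> U" "x \<in> cdom c" "\<rho> 0 x \<in> cdom d"
    and l: "length (as :: ('e \<Rightarrow>\<^sub>L real) list) = h" "length (vs :: 'e list) = k"
  have "tensor_preserved A h k UNIV id G"
    using tensor by (simp add: tensor_field_def)
  moreover have "id x \<in> cdom d"
    using x by simp
  ultimately have "G d (id x) as (map (tangent_map c d id x) vs) =
      G c x (map (\<lambda>a. a o\<^sub>L tangent_map c d id x) as) vs"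
    unfolding tensor_preserved_def using c d x(2) l by blast
  moreover have "tangent_map c d (\<rho> 0) x = tangent_map c d id x"
    using c x(1,2) by (rule tangent_map_eqI) simp
  ultimately show "G d (\<rho> 0 x) as (map (tangent_map c d (\<rho> 0) x) vs) =
      G c x (map (\<lambda>a. a o\<^sub>L tangent_map c d (\<rho> 0) x) as) vs"
    using x(1) by simp
qed

lemma tensor_preservedD:
  assumes "tensor_preserved A h k U f G" "c \<in> A" "d \<in> A" "x \<in> U" "x \<in> cdom c" "f x \<in> cdom d"
    and "length as = h" "length vs = k"
  shows "G d (f x) as (map (tangent_map c d f x) vs) =
    G c x (map (\<lambda>a. a o\<^sub>L tangent_map c d f x) as) vs"
  using assms unfolding tensor_preserved_def by blast

lemma tensor_preserved_add:
  assumes s: "tensor_preserved A h k U (\<rho> s) G" and t: "tensor_preserved A h k U (\<rho> t) G"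
  shows "tensor_preserved A h k U (\<rho> (s + t)) G"
  unfolding tensor_preserved_def
proof (intro ballI impI allI)
  fix c e x as vs
  assume c: "c \<in> A" and e: "e \<in> A" and x: "x \<in> U" "x \<in> cdom c" "\<rho> (s + t) x \<in> cdom e"
    and l: "length (as :: ('e \<Rightarrow>\<^sub>L real) list) = h" "length (vs :: 'e list) = k"
  obtain d where d: "d \<in> A" "\<rho> t x \<in> cdom d"
    by (rule chart_at)
  have sx: "\<rho> s (\<rho> t x) \<in> cdom e"
    using x by (simp add: act_add)
  let ?S = "tangent_map d e (\<rho> s) (\<rho> t x)" and ?T = "tangent_map c d (\<rho> t) x"
  have ST: "tangent_map c e (\<rho> (s + t)) x = ?S o\<^sub>L ?T"
    using c d(1) e x(1,2) d(2) x(3) by (rule tangent_map_act_add)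
  have "G e (\<rho> (s + t) x) as (map (tangent_map c e (\<rho> (s + t)) x) vs) =
      G e (\<rho> s (\<rho> t x)) as (map ?S (map ?T vs))"
    using x(1) by (simp add: ST act_add o_def blinfun_compose.rep_eq)
  also have "\<dots> = G d (\<rho> t x) (map (\<lambda>a. a o\<^sub>L ?S) as) (map ?T vs)"
    by (rule tensor_preservedD[OF s d(1) e act_in[OF x(1)] d(2) sx]) (simp_all add: l)
  also have "\<dots> = G c x (map (\<lambda>a. a o\<^sub>L ?T) (map (\<lambda>a. a o\<^sub>L ?S) as)) vs"
    by (rule tensor_preservedD[OF t c d(1) x(1,2) d(2)]) (simp_all add: l)
  also have "\<dots> = G c x (map (\<lambda>a. a o\<^sub>L tangent_map c e (\<rho> (s + t)) x) as) vs"
    by (simp add: ST o_def blinfun_compose_assoc blinfun_compose.rep_eq)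
  finally show "G e (\<rho> (s + t) x) as (map (tangent_map c e (\<rho> (s + t)) x) vs) =
      G c x (map (\<lambda>a. a o\<^sub>L tangent_map c e (\<rho> (s + t)) x) as) vs" .
qed

lemma tensor_along_generator_derivative:
  assumes c: "c \<in> A" and x: "x \<in> U" "x \<in> cdom c"
    and as: "length as = h" and vs: "length vs = k"
  shows "((\<lambda>r. G c (\<rho> (r *\<^sub>R v) x) as vs) has_real_derivative
    Dmap (\<lambda>u. G c (cinv c u) as vs) (cmap c x) (generator v c x)) (at 0)"
proof -
  let ?g = "\<lambda>u. G c (cinv c u) as vs"
  have "smooth_on (cmap c ` cdom c) ?g"
    using tensor c as vs unfolding tensor_field_def by blast
  then have "?g differentiable (at (cmap c x))"
    by (rule smooth_on_differentiable) (use x in auto)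
  then have "(?g has_derivative Dmap ?g (cmap c x)) (at (cmap c x))"
    by (rule has_derivative_Dmap)
  with c x have "((\<lambda>r. ?g (cmap c (\<rho> (r *\<^sub>R v) x))) has_vector_derivative
      Dmap ?g (cmap c x) (generator v c x)) (at 0)"
    by (rule has_vector_derivative_along_generator)
  then have "((\<lambda>r. G c (\<rho> (r *\<^sub>R v) x) as vs) has_vector_derivative
      Dmap ?g (cmap c x) (generator v c x)) (at 0)"
  proof (rule has_vector_derivative_transform_within_open[OF _ open_line[OF c x]])
    show "0 \<in> {r. (r *\<^sub>R v, cmap c x) \<in> act_dom c c}"
      using base_in_act_dom[OF c x] by simp
  qed (simp add: line_in_dom[OF c x] c)
  then show ?thesis
    by (simp add: has_real_derivative_iff_has_vector_derivative)
qed

text \<open>The three groups of terms in \<open>L\<^sub>Z G\<close> come from the motion of the base point, of the vectors and of the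
  covectors.  This identifies the algebraic formula that defines \<open>L\<^sub>Z G\<close> with the derivative of the
  pullbacks of \<open>G\<close>.\<close>

lemma lie_derivative_generator:
  assumes c: "c \<in> A" and x: "x \<in> U" "x \<in> cdom c"
    and as: "length as = h" and vs: "length vs = k"
  shows "((\<lambda>r. G c (\<rho> (r *\<^sub>R v) x)
      (map (\<lambda>a. a o\<^sub>L tangent_map c c (\<rho> (- (r *\<^sub>R v))) (\<rho> (r *\<^sub>R v) x)) as)
      (map (tangent_map c c (\<rho> (r *\<^sub>R v)) x) vs)) has_real_derivative
    lie_derivative (generator v) G c x as vs) (at 0)"
proof -
  let ?J = "vf_jacobian c (generator v) x"
  let ?D = "\<lambda>as vs. Dmap (\<lambda>u. G c (cinv c u) as vs) (cmap c x) (generator v c x)"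
  have id: "tangent_map c c (\<rho> 0) x = id_blinfun"
    using c x by (rule tangent_map_act_zero)
  have "((\<lambda>r. (\<lambda>r. G c (\<rho> (r *\<^sub>R v) x)) r
      (map (\<lambda>a. (\<lambda>a r. a o\<^sub>L tangent_map c c (\<rho> (- (r *\<^sub>R v))) (\<rho> (r *\<^sub>R v) x)) a r) as)
      (map (\<lambda>w. (\<lambda>w r. tangent_map c c (\<rho> (r *\<^sub>R v)) x w) w r) vs)) has_real_derivative
    ?D as vs + (\<Sum>j<k. (\<lambda>r. G c (\<rho> (r *\<^sub>R v) x)) 0 as (vs[j := ?J (vs ! j)]))
      + (\<Sum>i<h. (\<lambda>r. G c (\<rho> (r *\<^sub>R v) x)) 0 (as[i := (\<lambda>a. - (a o\<^sub>L ?J)) (as ! i)]) vs)) (at 0)"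
  proof (rule has_real_derivative_tensor[OF _ _ _ _ _ _ as vs])
    have "\<forall>\<^sub>F r in nhds 0. r \<in> {r. (r *\<^sub>R v, cmap c x) \<in> act_dom c c}"
      using open_line[OF c x] base_in_act_dom[OF c x] by (intro eventually_nhds_in_open) auto
    then show "\<forall>\<^sub>F r in nhds 0. multilinear h k (G c (\<rho> (r *\<^sub>R v) x))"
      by eventually_elim (simp add: line_in_dom[OF c x] multilinear_tensor c)
  next
    fix as :: "('e \<Rightarrow>\<^sub>L real) list" and vs :: "'e list"
    assume "length as = h" "length vs = k"
    with c x show "((\<lambda>r. G c (\<rho> (r *\<^sub>R v) x) as vs) has_real_derivative ?D as vs) (at 0)"
      by (rule tensor_along_generator_derivative)
  next
    fix a :: "'e \<Rightarrow>\<^sub>L real" and w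
    from bounded_linear.has_vector_derivative[OF blinfun.bounded_linear_right
        tangent_map_act_inverse_derivative[OF c x]]
    show "((\<lambda>r. (a o\<^sub>L tangent_map c c (\<rho> (- (r *\<^sub>R v))) (\<rho> (r *\<^sub>R v) x)) w) has_real_derivative
        (- (a o\<^sub>L ?J)) w) (at 0)"
      by (simp add: has_real_derivative_iff_has_vector_derivative blinfun.minus_left blinfun.minus_right)
  next
    fix a :: "'e \<Rightarrow>\<^sub>L real"
    show "a o\<^sub>L tangent_map c c (\<rho> (- (0 *\<^sub>R v))) (\<rho> (0 *\<^sub>R v) x) = a"
      using x(1) by (simp add: id blinfun_eqI)
  next
    fix w show "((\<lambda>r. tangent_map c c (\<rho> (r *\<^sub>R v)) x w) has_vector_derivative ?J w) (at 0)"
      using c x by (rule tangent_map_act_derivative)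
    show "tangent_map c c (\<rho> (0 *\<^sub>R v)) x w = w"
      by (simp add: id)
  qed
  moreover have "G c x (as[i := - (as ! i o\<^sub>L ?J)]) vs = - G c x (as[i := as ! i o\<^sub>L ?J]) vs"
    if "i < h" for i
  proof -
    have "linear (\<lambda>a. G c x (as[i := a]) vs)"
      using multilinear_tensor[OF c x(2)] as vs that by (simp add: multilinear_def)
    then show ?thesis
      by (rule linear_neg)
  qed
  ultimately show ?thesis
    using x(1) by (simp add: lie_derivative_def as vs sum_negf diff_add_eq)
qed

text \<open>The value at \<open>x\<close>, in the chart \<open>c\<close>, of \<open>\<rho>\<^sub>t\<^sup>* G\<close>, computed in a chart \<open>d\<close> around \<open>\<rho>\<^sub>t x\<close>.\<close>

definition pullback where
  "pullback t c d x as vs =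
     G d (\<rho> t x) (map (\<lambda>a. a o\<^sub>L tangent_map d c (\<rho> (- t)) (\<rho> t x)) as)
       (map (tangent_map c d (\<rho> t) x) vs)"

text \<open>An orbit need not stay in one chart, so that the chart at its endpoint has to change along the way.\<close>

lemma pullback_chart_independent:
  assumes c: "c \<in> A" and d: "d \<in> A" "d' \<in> A"
    and x: "x \<in> U" "x \<in> cdom c" and tx: "\<rho> t x \<in> cdom d" "\<rho> t x \<in> cdom d'"
    and l: "length as = h" "length vs = k"
  shows "pullback t c d' x as vs = pullback t c d x as vs"
proof -
  let ?y = "\<rho> t x"
  have y: "?y \<in> U" using x(1) by simp
  let ?I = "tangent_map d d' (\<rho> 0) ?y"
  have 1: "tangent_map c d' (\<rho> t) x = ?I o\<^sub>L tangent_map c d (\<rho> t) x"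
    using tangent_map_act_add[OF c d x tx(1), of 0] tx(2) by simp
  have 2: "tangent_map d c (\<rho> (- t)) ?y = tangent_map d' c (\<rho> (- t)) ?y o\<^sub>L ?I"
    using tangent_map_act_add[OF d c y tx(1), of 0 "- t"] tx(2) x y by simp
  have "G d' (\<rho> 0 ?y) (map (\<lambda>a. a o\<^sub>L tangent_map d' c (\<rho> (- t)) ?y) as)
      (map ?I (map (tangent_map c d (\<rho> t) x) vs)) =
    G d ?y (map (\<lambda>a. a o\<^sub>L ?I) (map (\<lambda>a. a o\<^sub>L tangent_map d' c (\<rho> (- t)) ?y) as))
      (map (tangent_map c d (\<rho> t) x) vs)"
    by (rule tensor_preservedD[OF tensor_preserved_zero d y tx(1)]) (simp_all add: y tx l)
  then show ?thesis
    using y by (simp add: pullback_def 1 2 o_def blinfun_compose_assoc blinfun_compose.rep_eq)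
qed

lemma pullback_derivative:
  assumes c: "c \<in> A" and d: "d \<in> A"
    and x: "x \<in> U" "x \<in> cdom c" and tx: "\<rho> t x \<in> cdom d"
    and l: "length as = h" "length vs = k"
  shows "((\<lambda>r. pullback (t + r *\<^sub>R v) c d x as vs) has_real_derivative
    lie_derivative (generator v) G d (\<rho> t x)
      (map (\<lambda>a. a o\<^sub>L tangent_map d c (\<rho> (- t)) (\<rho> t x)) as)
      (map (tangent_map c d (\<rho> t) x) vs)) (at 0)"
proof -
  let ?y = "\<rho> t x"
  have y: "?y \<in> U" using x(1) by simp
  let ?as = "map (\<lambda>a. a o\<^sub>L tangent_map d c (\<rho> (- t)) ?y) as"
  let ?vs = "map (tangent_map c d (\<rho> t) x) vs"
  have "((\<lambda>r. G d (\<rho> (r *\<^sub>R v) ?y)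
      (map (\<lambda>a. a o\<^sub>L tangent_map d d (\<rho> (- (r *\<^sub>R v))) (\<rho> (r *\<^sub>R v) ?y)) ?as)
      (map (tangent_map d d (\<rho> (r *\<^sub>R v)) ?y) ?vs)) has_vector_derivative
    lie_derivative (generator v) G d ?y ?as ?vs) (at 0)"
    unfolding has_real_derivative_iff_has_vector_derivative[symmetric]
    by (rule lie_derivative_generator[OF d y tx]) (simp_all add: l)
  then have "((\<lambda>r. pullback (t + r *\<^sub>R v) c d x as vs) has_vector_derivative
    lie_derivative (generator v) G d ?y ?as ?vs) (at 0)"
  proof (rule has_vector_derivative_transform_within_open[OF _ open_line[OF d y tx]])
    show "0 \<in> {r. (r *\<^sub>R v, cmap d ?y) \<in> act_dom d d}"
      using base_in_act_dom[OF d y tx] by simp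
    fix r assume "r \<in> {r. (r *\<^sub>R v, cmap d ?y) \<in> act_dom d d}"
    then have ry: "\<rho> (r *\<^sub>R v) ?y \<in> cdom d"
      by (simp add: line_in_dom[OF d y tx])
    have rt: "\<rho> (r *\<^sub>R v + t) x = \<rho> (r *\<^sub>R v) ?y"
      using x(1) by (rule act_add)
    have 1: "tangent_map c d (\<rho> (r *\<^sub>R v + t)) x =
        tangent_map d d (\<rho> (r *\<^sub>R v)) ?y o\<^sub>L tangent_map c d (\<rho> t) x"
      by (rule tangent_map_act_add[OF c d d x tx]) (simp add: rt ry)
    have "tangent_map d c (\<rho> (- t + - (r *\<^sub>R v))) (\<rho> (r *\<^sub>R v) ?y) =
        tangent_map d c (\<rho> (- t)) (\<rho> (- (r *\<^sub>R v)) (\<rho> (r *\<^sub>R v) ?y)) o\<^sub>L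
        tangent_map d d (\<rho> (- (r *\<^sub>R v))) (\<rho> (r *\<^sub>R v) ?y)"
      by (rule tangent_map_act_add[OF d d c _ ry])
         (simp_all only: act_add act_minus act_in x y tx)
    then have 2: "tangent_map d c (\<rho> (- (r *\<^sub>R v + t))) (\<rho> (r *\<^sub>R v) ?y) =
        tangent_map d c (\<rho> (- t)) ?y o\<^sub>L tangent_map d d (\<rho> (- (r *\<^sub>R v))) (\<rho> (r *\<^sub>R v) ?y)"
      by (simp only: act_minus[OF y] minus_add)
    show "G d (\<rho> (r *\<^sub>R v) ?y)
        (map (\<lambda>a. a o\<^sub>L tangent_map d d (\<rho> (- (r *\<^sub>R v))) (\<rho> (r *\<^sub>R v) ?y)) ?as)
        (map (tangent_map d d (\<rho> (r *\<^sub>R v)) ?y) ?vs) = pullback (t + r *\<^sub>R v) c d x as vs"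
      unfolding pullback_def add.commute[of t] rt 1 2
      by (simp add: o_def blinfun_compose_assoc blinfun_compose.rep_eq)
  qed
  then show ?thesis
    by (simp add: has_real_derivative_iff_has_vector_derivative)
qed

lemma multilinear_pullback:
  assumes d: "d \<in> A" and tx: "\<rho> t x \<in> cdom d"
  shows "multilinear h k (pullback t c d x)"
  unfolding multilinear_def
proof (intro allI impI conjI)
  fix as vs i
  assume l: "length (as :: ('e \<Rightarrow>\<^sub>L real) list) = h" "length (vs :: 'e list) = k"
  let ?as = "map (\<lambda>a. a o\<^sub>L tangent_map d c (\<rho> (- t)) (\<rho> t x)) as"
  let ?vs = "map (tangent_map c d (\<rho> t) x) vs"
  show "linear (\<lambda>a. pullback t c d x (as[i := a]) vs)" if "i < h"
  proof -
    have "linear (\<lambda>a. G d (\<rho> t x) (?as[i := a]) ?vs)"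
      using multilinear_tensor[OF d tx] l that by (simp add: multilinear_def)
    from linear_compose[OF bounded_linear.linear[OF
          bounded_bilinear.bounded_linear_left[OF bounded_bilinear_blinfun_compose]] this]
    show ?thesis
      by (simp add: pullback_def map_update o_def)
  qed
  show "linear (\<lambda>v. pullback t c d x as (vs[i := v]))" if "i < k"
  proof -
    have "linear (\<lambda>v. G d (\<rho> t x) ?as (?vs[i := v]))"
      using multilinear_tensor[OF d tx] l that by (simp add: multilinear_def)
    from linear_compose[OF bounded_linear.linear[OF blinfun.bounded_linear_right] this]
    show ?thesis
      by (simp add: pullback_def map_update o_def)
  qed
qed

end


section \<open>Tensor fields preserved by an integrable system\<close>

lemma blinfun_compose_id: "id_blinfun o\<^sub>L f = f" "f o\<^sub>L id_blinfun = f"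
  by (rule blinfun_eqI, simp)+

locale integrable_system_with_torus_action = tensor_with_torus_action A U \<rho> G h k
  for A :: "('m::topological_space, 'e::euclidean_space) chart set"
    and U :: "'m set" and \<rho> :: "real ^ 'p::finite \<Rightarrow> 'm \<Rightarrow> 'm"
    and G :: "('m, 'e) tfield" and h k :: nat +
  fixes X :: "'p \<Rightarrow> ('m, 'e) vfield" and F :: "nat \<Rightarrow> 'm \<Rightarrow> real" and q :: nat
  assumes system: "integrable_system A q X F"
    and liouville_action: "liouville_torus_action A q X F U \<rho>"
    and lie_zero: "\<And>i. tensor_zero A h k (lie_derivative (X i) G)"
begin

lemma has_derivative_vector_field:
  assumes c: "c \<in> A" and x: "x \<in> cdom c"
  shows "((X i c \<circ> cinv c) has_derivative vf_jacobian c (X i) x) (at (cmap c x))"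
proof -
  have "smooth_on (cmap c ` cdom c) (X i c \<circ> cinv c)"
    using system c by (simp add: integrable_system_def vector_field_def)
  then have "(X i c \<circ> cinv c) differentiable (at (cmap c x))"
    by (rule smooth_on_differentiable) (use x in auto)
  then show ?thesis
    unfolding vf_jacobian_def by (rule has_derivative_Dmap)
qed

lemma first_integral_smooth:
  assumes c: "c \<in> A" and j: "j < q"
  shows "smooth_on (cmap c ` cdom c) (F j \<circ> cinv c)"
proof -
  have "smooth_fun A UNIV (F j)"
    using system j unfolding integrable_system_def by blast
  then show ?thesis
    using c unfolding smooth_fun_def by force
qed

lemma has_derivative_first_integral:
  assumes c: "c \<in> A" and x: "x \<in> cdom c" and j: "j < q"
  shows "((F j \<circ> cinv c) has_derivative dfun c (F j) x) (at (cmap c x))"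
    and "dfun c (F j) x w = frechet_derivative (F j \<circ> cinv c) (at (cmap c x)) w"
proof -
  have "(F j \<circ> cinv c) differentiable (at (cmap c x))"
    using first_integral_smooth[OF c j] by (rule smooth_on_differentiable) (use x in auto)
  then show "((F j \<circ> cinv c) has_derivative dfun c (F j) x) (at (cmap c x))"
    and "dfun c (F j) x w = frechet_derivative (F j \<circ> cinv c) (at (cmap c x)) w"
    unfolding dfun_def by (simp_all add: has_derivative_Dmap Dmap_apply)
qed

lemma dfun_vector_field: "c \<in> A \<Longrightarrow> x \<in> cdom c \<Longrightarrow> j < q \<Longrightarrow> dfun c (F j) x (X i c x) = 0"
  using system unfolding integrable_system_def by blast

lemma dfun_generator:
  assumes c: "c \<in> A" and x: "x \<in> U" "x \<in> cdom c" and j: "j < q"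
  shows "dfun c (F j) x (generator v c x) = 0"
proof -
  have "((\<lambda>r. (F j \<circ> cinv c) (cmap c (\<rho> (r *\<^sub>R v) x))) has_vector_derivative
      dfun c (F j) x (generator v c x)) (at 0)"
    using c x has_derivative_first_integral(1)[OF c x(2) j]
    by (rule has_vector_derivative_along_generator)
  then have "((\<lambda>r. F j x) has_vector_derivative dfun c (F j) x (generator v c x)) (at 0)"
  proof (rule has_vector_derivative_transform_within_open[OF _ open_line[OF c x]])
    show "0 \<in> {r. (r *\<^sub>R v, cmap c x) \<in> act_dom c c}"
      using base_in_act_dom[OF c x] by simp
    fix r assume "r \<in> {r. (r *\<^sub>R v, cmap c x) \<in> act_dom c c}"
    then have "\<rho> (r *\<^sub>R v) x \<in> cdom c" by (simp add: line_in_dom[OF c x])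
    moreover have "F j (\<rho> (r *\<^sub>R v) x) = F j x"
      using liouville_action x(1) j unfolding liouville_torus_action_def by blast
    ultimately show "(F j \<circ> cinv c) (cmap c (\<rho> (r *\<^sub>R v) x)) = F j x"
      using c by simp
  qed
  then show ?thesis
    using has_vector_derivative_const by (rule vector_derivative_unique_at)
qed

lemma independent:
  assumes x: "x \<in> U" shows "independent_at A q X F x"
proof -
  have "regular_level_set A q X F (range (\<lambda>t. \<rho> t x))"
    using liouville_action x unfolding liouville_torus_action_def by blast
  moreover have "x \<in> range (\<lambda>t. \<rho> t x)"
    using act_zero[OF x] by (metis rangeI)
  ultimately show ?thesis
    unfolding regular_level_set_def by blast
qed

text \<open>At the points of \<open>U\<close> the fields \<open>X\<^sub>i\<close> span the whole common kernel of the \<open>dF\<^sub>j\<close>, the tangent space of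
  the orbit: the system is regular there, since \<open>x\<close> lies on its own orbit.\<close>

lemma spanned_by_system:
  assumes c: "c \<in> A" and x: "x \<in> U" "x \<in> cdom c"
    and z: "\<And>j. j < q \<Longrightarrow> dfun c (F j) x z = 0"
  obtains s where "z = (\<Sum>i\<in>UNIV. s i *\<^sub>R X i c x)"
proof (rule common_kernel_spanned[of "UNIV :: 'p set" "{..<q}" "\<lambda>i. X i c x" "\<lambda>j. dfun c (F j) x" z])
  show "DIM('e) = card (UNIV :: 'p set) + card {..<q}"
    using system by (simp add: integrable_system_def)
  show "vectors_wedge_nonzero UNIV (\<lambda>i. X i c x)" "covectors_wedge_nonzero {..<q} (\<lambda>j. dfun c (F j) x)"
    using independent[OF x(1)] c x(2) by (simp_all add: independent_at_def)
qed (use that z dfun_vector_field[OF c x(2)] in auto)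

text \<open>The coefficients \<open>s\<^sub>i\<close> are constants.  They will be chosen so that \<open>\<Sum>\<^sub>i s\<^sub>i X\<^sub>i = Z\<^sub>v\<close> on one orbit,
  the zero set of interest; on the neighboring orbits the difference need not vanish.\<close>

definition defect :: "('p \<Rightarrow> real) \<Rightarrow> real ^ 'p \<Rightarrow> ('m, 'e) vfield" where
  "defect s v c x = (\<Sum>i\<in>UNIV. s i *\<^sub>R X i c x) - generator v c x"

lemma defect_zero_exists:
  assumes c: "c \<in> A" and x: "x \<in> U" "x \<in> cdom c"
  obtains s where "defect s v c x = 0"
proof -
  obtain s where "generator v c x = (\<Sum>i\<in>UNIV. s i *\<^sub>R X i c x)"
    using spanned_by_system[OF c x dfun_generator[OF c x]] .
  then show thesis
    by (intro that[of s]) (simp add: defect_def)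
qed

lemma has_derivative_defect:
  assumes c: "c \<in> A" and x: "x \<in> U" "x \<in> cdom c"
  shows "((defect s v c \<circ> cinv c) has_derivative vf_jacobian c (defect s v) x) (at (cmap c x))"
    and "vf_jacobian c (defect s v) x =
      (\<Sum>i\<in>UNIV. s i *\<^sub>R vf_jacobian c (X i) x) - vf_jacobian c (generator v) x"
proof -
  let ?B = "(\<Sum>i\<in>UNIV. s i *\<^sub>R vf_jacobian c (X i) x) - vf_jacobian c (generator v) x"
  have "((\<lambda>u. (\<Sum>i\<in>UNIV. s i *\<^sub>R (X i c \<circ> cinv c) u) - (generator v c \<circ> cinv c) u) has_derivative
      (\<lambda>w. (\<Sum>i\<in>UNIV. s i *\<^sub>R vf_jacobian c (X i) x w) - vf_jacobian c (generator v) x w)) (at (cmap c x))"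
    by (intro has_derivative_diff has_derivative_sum has_derivative_scaleR_right
        has_derivative_vector_field[OF c x(2)] has_derivative_generator[OF c x])
  moreover have "(\<lambda>u. (\<Sum>i\<in>UNIV. s i *\<^sub>R (X i c \<circ> cinv c) u) - (generator v c \<circ> cinv c) u) =
      defect s v c \<circ> cinv c"
    by (simp add: fun_eq_iff defect_def)
  moreover have "(\<lambda>w. (\<Sum>i\<in>UNIV. s i *\<^sub>R vf_jacobian c (X i) x w) - vf_jacobian c (generator v) x w) =
      blinfun_apply ?B"
    by (simp add: fun_eq_iff blinfun.diff_left blinfun.sum_left blinfun.scaleR_left)
  ultimately have D: "((defect s v c \<circ> cinv c) has_derivative ?B) (at (cmap c x))"
    by simp
  then show B: "vf_jacobian c (defect s v) x = ?B"
    unfolding vf_jacobian_def[of c "defect s v"] by (rule Dmap_eqI)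
  show "((defect s v c \<circ> cinv c) has_derivative vf_jacobian c (defect s v) x) (at (cmap c x))"
    using D by (simp only: B)
qed

lemma tangent_map_vector_field:
  assumes "c \<in> A" "d \<in> A" "x \<in> U" "x \<in> cdom c" "\<rho> t x \<in> cdom d"
  shows "X i d (\<rho> t x) = tangent_map c d (\<rho> t) x (X i c x)"
  using liouville_action assms unfolding liouville_torus_action_def vf_preserved_def by blast

lemma tangent_map_defect:
  assumes "c \<in> A" "d \<in> A" "x \<in> U" "x \<in> cdom c" "\<rho> t x \<in> cdom d"
  shows "defect s v d (\<rho> t x) = tangent_map c d (\<rho> t) x (defect s v c x)"
  using tangent_map_vector_field[OF assms] tangent_map_generator[OF assms(1,3,4,2,5), of v]
  by (simp add: defect_def blinfun.diff_right blinfun.sum_right blinfun.scaleR_right)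

text \<open>The defect is an invariant vector field.  Differentiating the invariance at a zero of the field shows
  that its linear part there is invariant as well.\<close>

lemma defect_jacobian_conjugate:
  assumes c: "c \<in> A" and d: "d \<in> A" and x: "x \<in> U" "x \<in> cdom c" and tx: "\<rho> t x \<in> cdom d"
    and zero: "defect s v c x = 0"
  shows "vf_jacobian d (defect s v) (\<rho> t x) o\<^sub>L tangent_map c d (\<rho> t) x =
    tangent_map c d (\<rho> t) x o\<^sub>L vf_jacobian c (defect s v) x"
proof (rule blinfun_eqI)
  fix w
  let ?M = "\<lambda>u w. frechet_derivative (act_chart c d) (at (t, u)) (0, w)"
  let ?S = "{u. (t, u) \<in> act_dom c d}"
  have u0: "cmap c x \<in> ?S"
    using act_domI[OF c x tx] by simp
  have "((\<lambda>u. ?M u ((defect s v c \<circ> cinv c) u)) has_derivative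
      (\<lambda>w. ?M (cmap c x) (vf_jacobian c (defect s v) x w))) (at (cmap c x))"
  proof (rule has_derivative_linear_family_vanishing[where M = ?M and Y = "defect s v c \<circ> cinv c"
        and Y' = "vf_jacobian c (defect s v) x", OF open_act_dom_slice[OF c d] u0])
    fix u assume "u \<in> ?S"
    then have "linear (frechet_derivative (act_chart c d) (at (t, u)))"
      using act_chart_differentiable[OF c d] linear_frechet_derivative by blast
    from linear_compose[OF _ this, of "\<lambda>w. (0, w)"] show "linear (?M u)"
      by (simp add: o_def linearI)
  next
    fix b
    have "(\<lambda>p. frechet_derivative (act_chart c d) (at p) (0, b)) differentiable (at (t, cmap c x))"
      using smooth_on_frechet_derivative[OF smooth_act_chart[OF c d]] u0
      by (intro smooth_on_differentiable) auto
    then have "((\<lambda>p. frechet_derivative (act_chart c d) (at p) (0, b)) has_derivative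
        frechet_derivative (\<lambda>p. frechet_derivative (act_chart c d) (at p) (0, b)) (at (t, cmap c x)))
        (at (t, cmap c x))"
      by (simp only: frechet_derivative_works)
    from has_derivative_slice[OF this] show "(\<lambda>u. ?M u b) differentiable (at (cmap c x))"
      by (rule differentiableI)
  next
    show "((defect s v c \<circ> cinv c) has_derivative vf_jacobian c (defect s v) x) (at (cmap c x))"
      using c x by (rule has_derivative_defect)
    show "(defect s v c \<circ> cinv c) (cmap c x) = 0"
      using c x zero by simp
  qed
  then have 1: "((\<lambda>u. (defect s v d \<circ> cinv d) (act_chart c d (t, u))) has_derivative
      (\<lambda>w. ?M (cmap c x) (vf_jacobian c (defect s v) x w))) (at (cmap c x))"
  proof (rule has_derivative_transform_within_open[OF _ open_act_dom_slice[OF c d] u0])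
    fix u assume "u \<in> ?S"
    then have "(t, u) \<in> act_dom c d" by simp
    with c obtain y where y: "y \<in> U" "y \<in> cdom c" "\<rho> t y \<in> cdom d" "u = cmap c y" "cinv c u = y"
      by (rule act_domE)
    have "(defect s v d \<circ> cinv d) (act_chart c d (t, u)) = defect s v d (\<rho> t y)"
      using d y(3,5) by (simp add: act_chart_def)
    also have "\<dots> = tangent_map c d (\<rho> t) y (defect s v c y)"
      using c d y(1-3) by (rule tangent_map_defect)
    also have "\<dots> = ?M u ((defect s v c \<circ> cinv c) u)"
      using has_derivative_tangent_map(2)[OF c d y(1-3)] y(4,5) by simp
    finally show "?M u ((defect s v c \<circ> cinv c) u) = (defect s v d \<circ> cinv d) (act_chart c d (t, u))" ..
  qed
  have "act_chart c d (t, cmap c x) = cmap d (\<rho> t x)"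
    using c x by (simp add: act_chart_def)
  then have "((defect s v d \<circ> cinv d) has_derivative vf_jacobian d (defect s v) (\<rho> t x))
      (at (act_chart c d (t, cmap c x)))"
    using has_derivative_defect(1)[OF d act_in[OF x(1)] tx] by simp
  from has_derivative_compose[OF has_derivative_tangent_map(1)[OF c d x tx] this]
  have "vf_jacobian d (defect s v) (\<rho> t x) (tangent_map c d (\<rho> t) x w) =
      ?M (cmap c x) (vf_jacobian c (defect s v) x w)"
    using 1 by (rule fun_cong[OF has_derivative_unique])
  then show "(vf_jacobian d (defect s v) (\<rho> t x) o\<^sub>L tangent_map c d (\<rho> t) x) w =
      (tangent_map c d (\<rho> t) x o\<^sub>L vf_jacobian c (defect s v) x) w"
    by (simp add: has_derivative_tangent_map(2)[OF c d x tx])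
qed

text \<open>The defect is everywhere tangent to the level sets of the \<open>F\<^sub>j\<close>; at a zero, this is inherited by the
  image of its linear part.\<close>

lemma dfun_defect_jacobian:
  assumes c: "c \<in> A" and x: "x \<in> U" "x \<in> cdom c" and zero: "defect s v c x = 0" and j: "j < q"
  shows "dfun c (F j) x (vf_jacobian c (defect s v) x w) = 0"
proof -
  let ?f = "F j \<circ> cinv c"
  let ?S = "cmap c ` (cdom c \<inter> U)"
  have S: "open ?S" "cmap c x \<in> ?S"
    using open_cmap_image[OF c open_U] x by auto
  have sm: "smooth_on (cmap c ` cdom c) ?f"
    using c j by (rule first_integral_smooth)
  have "((\<lambda>u. frechet_derivative ?f (at u) ((defect s v c \<circ> cinv c) u)) has_derivative
      (\<lambda>w. frechet_derivative ?f (at (cmap c x)) (vf_jacobian c (defect s v) x w))) (at (cmap c x))"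
  proof (rule has_derivative_linear_family_vanishing[where M = "\<lambda>u. frechet_derivative ?f (at u)"
        and Y = "defect s v c \<circ> cinv c" and Y' = "vf_jacobian c (defect s v) x", OF S])
    show "linear (frechet_derivative ?f (at u))" if "u \<in> ?S" for u
      by (rule linear_frechet_derivative, rule smooth_on_differentiable[OF sm]) (use that in auto)
    show "(\<lambda>u. frechet_derivative ?f (at u) b) differentiable (at (cmap c x))" for b
      by (rule smooth_on_differentiable[OF smooth_on_frechet_derivative[OF sm]]) (use x in auto)
    show "((defect s v c \<circ> cinv c) has_derivative vf_jacobian c (defect s v) x) (at (cmap c x))"
      using c x by (rule has_derivative_defect)
    show "(defect s v c \<circ> cinv c) (cmap c x) = 0"
      using c x zero by simp
  qed
  then have "((\<lambda>u. 0) has_derivative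
      (\<lambda>w. frechet_derivative ?f (at (cmap c x)) (vf_jacobian c (defect s v) x w))) (at (cmap c x))"
  proof (rule has_derivative_transform_within_open[OF _ S])
    fix u assume "u \<in> ?S"
    then obtain y where y: "u = cmap c y" "y \<in> U" "y \<in> cdom c" by auto
    have "dfun c (F j) y (defect s v c y) = 0"
      using dfun_vector_field[OF c y(3) j] dfun_generator[OF c y(2,3) j]
      by (simp add: defect_def blinfun.diff_right blinfun.sum_right blinfun.scaleR_right)
    then show "frechet_derivative ?f (at u) ((defect s v c \<circ> cinv c) u) = 0"
      using c y by (simp add: has_derivative_first_integral(2)[OF c y(3) j])
  qed
  from fun_cong[OF has_derivative_unique[OF this has_derivative_const], of w]
  show ?thesis
    by (simp add: has_derivative_first_integral(2)[OF c x(2) j])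
qed

text \<open>This is \<open>[Z\<^sub>v, X\<^sub>i] = 0\<close>, obtained by differentiating the invariance of \<open>X\<^sub>i\<close> along an orbit.\<close>

lemma generator_commutes:
  assumes c: "c \<in> A" and x: "x \<in> U" "x \<in> cdom c"
  shows "vf_jacobian c (X i) x (generator v c x) = vf_jacobian c (generator v) x (X i c x)"
proof -
  have "((\<lambda>r. (X i c \<circ> cinv c) (cmap c (\<rho> (r *\<^sub>R v) x))) has_vector_derivative
      vf_jacobian c (X i) x (generator v c x)) (at 0)"
    using c x has_derivative_vector_field[OF c x(2)] by (rule has_vector_derivative_along_generator)
  then have "((\<lambda>r. tangent_map c c (\<rho> (r *\<^sub>R v)) x (X i c x)) has_vector_derivative
      vf_jacobian c (X i) x (generator v c x)) (at 0)"
  proof (rule has_vector_derivative_transform_within_open[OF _ open_line[OF c x]])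
    show "0 \<in> {r. (r *\<^sub>R v, cmap c x) \<in> act_dom c c}"
      using base_in_act_dom[OF c x] by simp
    fix r assume "r \<in> {r. (r *\<^sub>R v, cmap c x) \<in> act_dom c c}"
    then have "\<rho> (r *\<^sub>R v) x \<in> cdom c" by (simp add: line_in_dom[OF c x])
    then show "(X i c \<circ> cinv c) (cmap c (\<rho> (r *\<^sub>R v) x)) = tangent_map c c (\<rho> (r *\<^sub>R v)) x (X i c x)"
      using c tangent_map_vector_field[OF c c x] by simp
  qed
  then show ?thesis
    using tangent_map_act_derivative[OF c x] by (rule vector_derivative_unique_at)
qed

lemma vector_fields_commute:
  assumes "c \<in> A" "x \<in> cdom c"
  shows "vf_jacobian c (X i) x (X j c x) = vf_jacobian c (X j) x (X i c x)"
proof -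
  have "lie_bracket (X i) (X j) c x = 0"
    using system assms unfolding integrable_system_def by blast
  then show ?thesis
    by (simp add: lie_bracket_def)
qed

text \<open>The linear part \<open>B\<close> takes its values in the span of the \<open>X\<^sub>i\<close>, and it kills every \<open>X\<^sub>i\<close>: the defect
  commutes with \<open>X\<^sub>i\<close>, so that at a zero of the defect \<open>B X\<^sub>i\<close> is their bracket, which is \<open>0\<close>.\<close>

lemma defect_jacobian_nilpotent:
  assumes c: "c \<in> A" and x: "x \<in> U" "x \<in> cdom c" and zero: "defect s v c x = 0"
  shows "vf_jacobian c (defect s v) x o\<^sub>L vf_jacobian c (defect s v) x = 0"
proof (rule blinfun_eqI)
  fix w
  let ?B = "vf_jacobian c (defect s v) x"
  have BX: "?B (X i c x) = 0" for i
  proof -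
    have "?B (X i c x) = vf_jacobian c (X i) x (defect s v c x)"
      unfolding has_derivative_defect(2)[OF c x] defect_def
      by (simp add: blinfun.diff_right blinfun.sum_right blinfun.scaleR_right blinfun.diff_left
          blinfun.sum_left blinfun.scaleR_left generator_commutes[OF c x]
          vector_fields_commute[OF c x(2), of i])
    then show ?thesis
      using zero by simp
  qed
  obtain a where "?B w = (\<Sum>i\<in>UNIV. a i *\<^sub>R X i c x)"
    using spanned_by_system[OF c x dfun_defect_jacobian[OF c x zero]] .
  then show "(?B o\<^sub>L ?B) w = blinfun_apply 0 w"
    by (simp add: blinfun.sum_right blinfun.scaleR_right BX)
qed

text \<open>For \<open>X = \<Sum>\<^sub>i s\<^sub>i X\<^sub>i\<close> one has \<open>L\<^sub>X G = 0\<close>.  As \<open>X\<close> and \<open>Z\<^sub>v\<close> agree at the point, the terms with a derivative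
  of \<open>G\<close> cancel in \<open>L\<^sub>Z G = L\<^sub>Z G - L\<^sub>X G\<close>, and only the algebraic action of the linear part of \<open>X - Z\<^sub>v\<close>
  is left.\<close>

lemma lie_derivative_generator_defect:
  assumes c: "c \<in> A" and x: "x \<in> U" "x \<in> cdom c" and zero: "defect s v c x = 0"
    and as: "length as = h" and vs: "length vs = k"
  shows "lie_derivative (generator v) G c x as vs =
    (\<Sum>i<h. G c x (as[i := as ! i o\<^sub>L vf_jacobian c (defect s v) x]) vs)
    - (\<Sum>j<k. G c x as (vs[j := vf_jacobian c (defect s v) x (vs ! j)]))"
proof -
  let ?D = "Dmap (\<lambda>u. G c (cinv c u) as vs) (cmap c x)"
  \<comment> \<open>the part of the Lie derivative that depends on the Jacobian of the field, linearly\<close>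
  let ?E = "\<lambda>b. (\<Sum>j<k. G c x as (vs[j := blinfun_apply b (vs ! j)])) -
    (\<Sum>i<h. G c x (as[i := as ! i o\<^sub>L b]) vs)"
  have lie: "lie_derivative Y G c x as vs = ?D (Y c x) + ?E (vf_jacobian c Y x)" for Y
    by (simp add: lie_derivative_def as vs)
  have "linear (\<lambda>b. G c x (as[i := as ! i o\<^sub>L b]) vs)" if "i < h" for i
  proof -
    have "linear (\<lambda>a. G c x (as[i := a]) vs)"
      using multilinear_tensor[OF c x(2)] as vs that by (simp add: multilinear_def)
    from linear_compose[OF bounded_linear.linear[OF
          bounded_bilinear.bounded_linear_right[OF bounded_bilinear_blinfun_compose]] this]
    show ?thesis by (simp add: o_def)
  qed
  moreover have "linear (\<lambda>b. G c x as (vs[j := blinfun_apply b (vs ! j)]))" if "j < k" for j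
  proof -
    have "linear (\<lambda>w. G c x as (vs[j := w]))"
      using multilinear_tensor[OF c x(2)] as vs that by (simp add: multilinear_def)
    from linear_compose[OF bounded_linear.linear[OF blinfun.bounded_linear_left] this]
    show ?thesis by (simp add: o_def)
  qed
  ultimately have "linear ?E"
    by (intro linear_compose_sub linear_compose_sum) auto
  then interpret E: linear ?E .
  let ?J = "\<lambda>i. vf_jacobian c (X i) x"
  have "?D (X i c x) + ?E (?J i) = 0" for i
    using lie_zero[of i] c x(2) as vs unfolding tensor_zero_def lie[symmetric] by blast
  then have "0 = (\<Sum>i\<in>UNIV. s i *\<^sub>R (?D (X i c x) + ?E (?J i)))"
    by simp
  also have "\<dots> = ?D (\<Sum>i\<in>UNIV. s i *\<^sub>R X i c x) + ?E (\<Sum>i\<in>UNIV. s i *\<^sub>R ?J i)"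
    unfolding E.sum E.scale blinfun.sum_right blinfun.scaleR_right
    by (simp only: scaleR_add_right sum.distrib)
  also have "(\<Sum>i\<in>UNIV. s i *\<^sub>R X i c x) = generator v c x"
    using zero by (simp add: defect_def)
  also have "(\<Sum>i\<in>UNIV. s i *\<^sub>R ?J i) =
      vf_jacobian c (defect s v) x + vf_jacobian c (generator v) x"
    by (simp add: has_derivative_defect(2)[OF c x])
  also have "?E (vf_jacobian c (defect s v) x + vf_jacobian c (generator v) x) =
      ?E (vf_jacobian c (defect s v) x) + ?E (vf_jacobian c (generator v) x)"
    by (rule E.add)
  finally show ?thesis
    unfolding lie by linarith
qed

text \<open>The linear part of the defect at \<open>\<rho>\<^sub>t x\<close> is conjugate to the one at \<open>x\<close>.  Hence the pullbacks to \<open>x\<close>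
  satisfy a linear equation whose coefficients do not depend on \<open>t\<close>.\<close>

lemma pullback_derivative_defect:
  assumes c: "c \<in> A" and d: "d \<in> A"
    and x: "x \<in> U" "x \<in> cdom c" and tx: "\<rho> t x \<in> cdom d"
    and zero: "defect s v c x = 0" and l: "length as = h" "length vs = k"
  shows "((\<lambda>r. pullback (t + r *\<^sub>R v) c d x as vs) has_real_derivative
    (\<Sum>i<h. pullback t c d x (as[i := as ! i o\<^sub>L vf_jacobian c (defect s v) x]) vs)
    - (\<Sum>j<k. pullback t c d x as (vs[j := vf_jacobian c (defect s v) x (vs ! j)]))) (at 0)"
proof -
  let ?B = "vf_jacobian c (defect s v) x" and ?C = "vf_jacobian d (defect s v) (\<rho> t x)"
  let ?T = "tangent_map c d (\<rho> t) x" and ?T' = "tangent_map d c (\<rho> (- t)) (\<rho> t x)"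
  let ?as = "map (\<lambda>a. a o\<^sub>L ?T') as" and ?vs = "map ?T vs"
  have y: "\<rho> t x \<in> U" using x(1) by simp
  have zero': "defect s v d (\<rho> t x) = 0"
    using tangent_map_defect[OF c d x tx] zero by simp
  have TT': "?T o\<^sub>L ?T' = id_blinfun"
    using tangent_map_act_add[OF d c d y tx, of "- t" t] tangent_map_act_zero[OF d y tx] x tx by simp
  have CT: "?C o\<^sub>L ?T = ?T o\<^sub>L ?B"
    using c d x tx zero by (rule defect_jacobian_conjugate)
  have "?T' o\<^sub>L ?T = id_blinfun"
    using tangent_map_act_add[OF c d c x tx, of "- t"] tangent_map_act_zero[OF c x] x by simp
  then have T'C: "?T' o\<^sub>L ?C = ?B o\<^sub>L ?T'"
    by (metis (no_types, lifting) CT TT' blinfun_compose_assoc blinfun_compose_id)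
  have "pullback t c d x (as[i := as ! i o\<^sub>L ?B]) vs =
      G d (\<rho> t x) (?as[i := ?as ! i o\<^sub>L ?C]) ?vs" if "i < h" for i
    using that l by (simp add: pullback_def map_update blinfun_compose_assoc T'C)
  moreover have "pullback t c d x as (vs[j := ?B (vs ! j)]) =
      G d (\<rho> t x) ?as (?vs[j := ?C (?vs ! j)])" if "j < k" for j
    using that l fun_cong[OF arg_cong[OF CT, of blinfun_apply], of "vs ! j"]
    by (simp add: pullback_def map_update)
  ultimately show ?thesis
    using pullback_derivative[OF c d x tx l, of v]
      lie_derivative_generator_defect[OF d y tx zero', of ?as ?vs] l by simp
qed

text \<open>In a direction of the lattice the pullbacks \<open>\<rho>\<^sub>r\<^sub>v\<^sup>* G\<close> at \<open>x\<close> are periodic in \<open>r\<close> and solve a linear equation with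
  constant nilpotent coefficients, so they are all equal to \<open>G\<close>.\<close>

lemma tensor_preserved_periodic_direction:
  assumes v: "v \<in> integer_lattice"
  shows "tensor_preserved A h k U (\<rho> (r *\<^sub>R v)) G"
  unfolding tensor_preserved_def
proof (intro ballI impI allI)
  fix c d x as vs
  assume c: "c \<in> A" and d: "d \<in> A" and x: "x \<in> U" "x \<in> cdom c" and rx: "\<rho> (r *\<^sub>R v) x \<in> cdom d"
    and l: "length (as :: ('e \<Rightarrow>\<^sub>L real) list) = h" "length (vs :: 'e list) = k"
  have "\<forall>z. \<exists>e. e \<in> A \<and> z \<in> cdom e"
    using chart_at by blast
  then obtain ch where "\<forall>z. ch z \<in> A \<and> z \<in> cdom (ch z)"
    by (rule choice[THEN exE])
  then have ch: "ch z \<in> A" "z \<in> cdom (ch z)" for z by auto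
  obtain s where zero: "defect s v c x = 0"
    using defect_zero_exists[OF c x] .
  let ?B = "vf_jacobian c (defect s v) x"
  \<comment> \<open>the pullback of \<open>G\<close> to \<open>x\<close>, computed in whichever chart \<open>ch\<close> picks at the endpoint\<close>
  define f where "f = (\<lambda>r. pullback (r *\<^sub>R v) c (ch (\<rho> (r *\<^sub>R v) x)) x)"
  have f_chart: "f r as vs = pullback (r *\<^sub>R v) c d x as vs"
    if "d \<in> A" "\<rho> (r *\<^sub>R v) x \<in> cdom d" "length as = h" "length vs = k" for r d as vs
    unfolding f_def by (rule pullback_chart_independent) (use that c x ch in auto)
  have deriv: "((\<lambda>r. f r as vs) has_real_derivative
      (\<Sum>i<h. f r (as[i := as ! i o\<^sub>L ?B]) vs) - (\<Sum>j<k. f r as (vs[j := ?B (vs ! j)]))) (at r)"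
    if l: "length as = h" "length vs = k" for r as vs
  proof -
    let ?y = "\<rho> (r *\<^sub>R v) x"
    let ?d = "ch ?y"
    let ?f' = "(\<Sum>i<h. f r (as[i := as ! i o\<^sub>L ?B]) vs) - (\<Sum>j<k. f r as (vs[j := ?B (vs ! j)]))"
    have d: "?d \<in> A" and y: "?y \<in> U" "?y \<in> cdom ?d"
      using ch x by auto
    have "((\<lambda>e. pullback (r *\<^sub>R v + e *\<^sub>R v) c ?d x as vs) has_vector_derivative ?f') (at 0)"
      using pullback_derivative_defect[OF c d x y(2) zero l]
      by (simp add: f_def has_real_derivative_iff_has_vector_derivative)
    then have "((\<lambda>e. f (r + e) as vs) has_vector_derivative ?f') (at 0)"
    proof (rule has_vector_derivative_transform_within_open[OF _ open_line[OF d y]])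
      show "0 \<in> {e. (e *\<^sub>R v, cmap ?d ?y) \<in> act_dom ?d ?d}"
        using base_in_act_dom[OF d y] by simp
      fix e assume "e \<in> {e. (e *\<^sub>R v, cmap ?d ?y) \<in> act_dom ?d ?d}"
      then have "\<rho> (e *\<^sub>R v) ?y \<in> cdom ?d" by (simp add: line_in_dom[OF d y])
      then have "\<rho> ((r + e) *\<^sub>R v) x \<in> cdom ?d"
        using x(1) by (simp add: scaleR_add_left act_add[symmetric] add.commute)
      from f_chart[OF d this l]
      show "pullback (r *\<^sub>R v + e *\<^sub>R v) c ?d x as vs = f (r + e) as vs"
        by (simp add: scaleR_add_left)
    qed
    then have "((\<lambda>e. f (r + e) as vs) has_real_derivative ?f') (at 0)"
      by (simp only: has_real_derivative_iff_has_vector_derivative)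
    then show ?thesis
      using DERIV_shift[of "\<lambda>r. f r as vs" ?f' 0 r] by (simp add: add.commute)
  qed
  have per: "f 1 as vs = f 0 as vs" for as vs
  proof -
    have "- v \<in> integer_lattice"
      using v by (simp add: integer_lattice_def)
    then have eq: "\<rho> v z = \<rho> 0 z" "\<rho> (- v) z = \<rho> (- 0) z" if "z \<in> U" for z
      using v that by (simp_all add: act_lattice)
    have 1: "tangent_map c e (\<rho> v) x = tangent_map c e (\<rho> 0) x" for e
      using c x eq(1) by (rule tangent_map_eqI)
    have 2: "tangent_map (ch x) c (\<rho> (- v)) x = tangent_map (ch x) c (\<rho> (- 0)) x"
      using ch(1) x(1) ch(2) eq(2) by (rule tangent_map_eqI)
    show ?thesis
      using eq(1)[OF x(1)] x(1) 1 2 by (simp add: f_def pullback_def)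
  qed
  have ml: "multilinear h k (f r)" for r
    unfolding f_def by (rule multilinear_pullback) (use ch in auto)
  have const: "f r as vs = f 0 as vs" if "length as = h" "length vs = k" for as vs
    using defect_jacobian_nilpotent[OF c x zero] ml deriv per that by (rule nilpotent_periodic_constant)
  let ?T = "tangent_map c d (\<rho> (r *\<^sub>R v)) x"
  let ?T' = "tangent_map d c (\<rho> (- (r *\<^sub>R v))) (\<rho> (r *\<^sub>R v) x)"
  let ?as = "map (\<lambda>a. a o\<^sub>L ?T) as"
  have y: "\<rho> (r *\<^sub>R v) x \<in> U" using x(1) by simp
  have TT': "?T o\<^sub>L ?T' = id_blinfun"
    using tangent_map_act_add[OF d c d y rx, of "- (r *\<^sub>R v)" "r *\<^sub>R v"]
      tangent_map_act_zero[OF d y rx] x rx by simp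
  \<comment> \<open>the covectors \<open>?as\<close> are chosen so that their transport to the endpoint gives back \<open>as\<close>\<close>
  have "f r ?as vs = pullback (r *\<^sub>R v) c d x ?as vs"
    using d rx l by (intro f_chart) auto
  also have "\<dots> = G d (\<rho> (r *\<^sub>R v) x) as (map ?T vs)"
    by (simp add: pullback_def o_def blinfun_compose_assoc TT' blinfun_compose_id)
  finally have 1: "f r ?as vs = G d (\<rho> (r *\<^sub>R v) x) as (map ?T vs)" .
  have "f 0 ?as vs = pullback (0 *\<^sub>R v) c c x ?as vs"
    using c x l by (intro f_chart) auto
  also have "\<dots> = G c x ?as vs"
    using x(1) by (simp add: pullback_def o_def tangent_map_act_zero[OF c x] blinfun_compose_id)
  finally have 2: "f 0 ?as vs = G c x ?as vs" .
  show "G d (\<rho> (r *\<^sub>R v) x) as (map ?T vs) = G c x ?as vs"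
    using const[of ?as vs] l by (simp add: 1 2)
qed

text \<open>The coordinate directions are lattice directions, and they generate the torus.\<close>

lemma tensor_preserved_torus: "tensor_preserved A h k U (\<rho> t) G"
proof -
  have "tensor_preserved A h k U (\<rho> (\<Sum>i\<in>I. (t $ i) *\<^sub>R axis i 1)) G" for I
  proof (induction I rule: infinite_finite_induct)
    case (insert i I)
    have "axis i 1 \<in> integer_lattice"
      by (simp add: integer_lattice_def axis_def)
    with insert show ?case
      by (simp add: tensor_preserved_add tensor_preserved_periodic_direction)
  qed (simp_all add: tensor_preserved_zero)
  from this[of UNIV] show ?thesis
    using basis_expansion[of t] by (simp add: scalar_mult_eq_scaleR)
qed

end

theorem theorem2p2:
  fixes A :: "('m::{t2_space,second_countable_topology}, 'e::euclidean_space) chart set"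
    and X :: "'p::finite \<Rightarrow> ('m, 'e) vfield"
    and F :: "nat \<Rightarrow> 'm \<Rightarrow> real"
    and G :: "('m, 'e) tfield"
    and \<rho> :: "real ^ 'p \<Rightarrow> 'm \<Rightarrow> 'm"
    and N U :: "'m set"
    and q h k :: nat
  assumes "smooth_atlas A"
    and "integrable_system A q X F"
    and "liouville_torus A q X F N"
    and "tensor_field A h k G"
    and "\<And>i. tensor_zero A h k (lie_derivative (X i) G)"
    and "tubular_neighborhood A TYPE('p) N U"
    and "liouville_torus_action A q X F U \<rho>"
  shows "\<forall>t. tensor_preserved A h k U (\<rho> t) G"
proof -
  interpret integrable_system_with_torus_action A U \<rho> G h k X F q
  proof unfold_locales
    show "open U"
      using assms(6) by (simp add: tubular_neighborhood_def)
    show "torus_action A U \<rho>"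
      using assms(7) by (simp add: liouville_torus_action_def)
  qed (fact assms)+
  show ?thesis
    by (simp add: tensor_preserved_torus)
qed

end
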